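(* Let $\lambda_0\in\mathbb R$ and let $v$ satisfy Assumptions A and B at $\lambda_0$ (see context). Then there are a neighborhood $U$ of $\lambda_0$ and constants $\hbar_0,C>0$ such that for every $\hbar\in(0,\hbar_0]$ and every eigenvalue $\lambda=\lambda(\hbar)\in U$ of $H_\hbar$ with real normalized eigenfunction $\psi(x;\lambda,\hbar)$ (i.e. $\int_{-\infty}^\infty\psi^2dx=1$), the kinetic energy $K(\lambda,\hbar)=\hbar^2\int_{-\infty}^\infty\psi'(x;\lambda,\hbar)^2dx$ satisfies $$|K(\lambda,\hbar)-K_{cl}(\lambda)|\le C\hbar^{1/3},$$ where $$K_{cl}(\lambda)=\int_{x_-(\lambda)}^{x_+(\lambda)}(\lambda-v(x))^{1/2}dx\,\Big(\int_{x_-(\lambda)}^{x_+(\lambda)}(\lambda-v(x))^{-1/2}dx\Big)^{-1}.$$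
   Context: Let $v:\mathbb R\to\mathbb R$ and, for $\lambda\in\mathbb R$, $q(x)=q(x;\lambda)=v(x)-\lambda$. Assumption A at $\lambda$: $v\in C^2(\mathbb R)$ and, for some $\rho_0>1$, the function $\big(|q(x)|^{-3}q'(x)^2+q(x)^{-2}|q''(x)|\big)\big|\int_0^x|q(y)|^{1/2}dy\big|^{\rho_0}$ is bounded for sufficiently large $|x|$. Assumption B at $\lambda$: the equation $v(x)=\lambda$ has exactly two solutions $x_-(\lambda)<x_+(\lambda)$; $v(x)<\lambda$ for $x\in(x_-(\lambda),x_+(\lambda))$, $v(x)>\lambda$ for $x\notin[x_-(\lambda),x_+(\lambda)]$, $\liminf_{|x|\to\infty}v(x)>\lambda$; $v$ is of class $C^3$ in some neighborhoods of $x_\pm(\lambda)$ and $\pm v'(x_\pm(\lambda))>0$. (If B holds at $\lambda_0$, it holds for all $\lambda$ in a neighborhood of $\lambda_0$.) $H_\hbar=-\hbar^2\frac{d^2}{dx^2}+v(x)$ is the Schrödinger operator in $L^2(\mathbb R)$, $\hbar>0$; $\lambda$ is an eigenvalue if $-\hbar^2\psi''+v\psi=\lambda\psi$ has a nonzero solution $\psi\in L^2(\mathbb R)$. *)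

theory Defs
  imports "HOL-Analysis.Analysis"
begin

text \<open>Membership in C^k(S), for an open set S.\<close>

definition Ck_on :: "nat \<Rightarrow> (real \<Rightarrow> real) \<Rightarrow> real set \<Rightarrow> bool" where
  "Ck_on k f S \<longleftrightarrow>
     (\<forall>j<k. \<forall>x\<in>S. (deriv ^^ j) f differentiable (at x)) \<and> continuous_on S ((deriv ^^ k) f)"

definition q :: "(real \<Rightarrow> real) \<Rightarrow> real \<Rightarrow> real \<Rightarrow> real" where
  "q v lam x = v x - lam"

text \<open>The condition that q does not vanish makes explicit that the function claimed to be
  bounded is defined near infinity (division by zero is total in HOL).\<close>

definition assumption_A :: "(real \<Rightarrow> real) \<Rightarrow> real \<Rightarrow> bool" where
  "assumption_A v lam \<longleftrightarrow>
     Ck_on 2 v UNIV \<and>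
     (\<exists>\<rho>>1. \<exists>M R. \<forall>x. \<bar>x\<bar> \<ge> R \<longrightarrow>
        q v lam x \<noteq> 0 \<and>
        \<bar>((deriv (q v lam) x)\<^sup>2 / \<bar>q v lam x\<bar> ^ 3
           + \<bar>(deriv ^^ 2) (q v lam) x\<bar> / (q v lam x)\<^sup>2)
          * \<bar>LBINT y=0..x. sqrt \<bar>q v lam y\<bar>\<bar> powr \<rho>\<bar> \<le> M)"

text \<open>The turning points: the smaller and the larger solution of v x = lam. They are meaningful
  only when there are exactly two solutions, as required in \<open>assumption_B\<close>.\<close>

definition x_minus :: "(real \<Rightarrow> real) \<Rightarrow> real \<Rightarrow> real" where
  "x_minus v lam = Min {x. v x = lam}"

definition x_plus :: "(real \<Rightarrow> real) \<Rightarrow> real \<Rightarrow> real" where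
  "x_plus v lam = Max {x. v x = lam}"

definition assumption_B :: "(real \<Rightarrow> real) \<Rightarrow> real \<Rightarrow> bool" where
  "assumption_B v lam \<longleftrightarrow>
     card {x. v x = lam} = 2 \<and>
     (\<forall>x\<in>{x_minus v lam<..<x_plus v lam}. v x < lam) \<and>
     (\<forall>x. x \<notin> {x_minus v lam..x_plus v lam} \<longrightarrow> v x > lam) \<and>
     Liminf at_infinity (\<lambda>x. ereal (v x)) > ereal lam \<and>
     (\<exists>N. open N \<and> x_minus v lam \<in> N \<and> Ck_on 3 v N) \<and>
     (\<exists>N. open N \<and> x_plus v lam \<in> N \<and> Ck_on 3 v N) \<and>
     deriv v (x_plus v lam) > 0 \<and> - deriv v (x_minus v lam) > 0"

text \<open>Classical square-integrable solutions. Since the coefficients are real, restricting to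
  real-valued solutions does not change the set of (real) eigenvalues.\<close>

definition eigenfunction :: "(real \<Rightarrow> real) \<Rightarrow> real \<Rightarrow> real \<Rightarrow> (real \<Rightarrow> real) \<Rightarrow> bool" where
  "eigenfunction v h lam \<psi> \<longleftrightarrow>
     (\<forall>x. \<psi> differentiable (at x) \<and> deriv \<psi> differentiable (at x)) \<and>
     (\<forall>x. - h\<^sup>2 * (deriv ^^ 2) \<psi> x + v x * \<psi> x = lam * \<psi> x) \<and>
     integrable lborel (\<lambda>x. (\<psi> x)\<^sup>2) \<and>
     (\<exists>x. \<psi> x \<noteq> 0)"

definition eigenvalue :: "(real \<Rightarrow> real) \<Rightarrow> real \<Rightarrow> real \<Rightarrow> bool" where
  "eigenvalue v h lam \<longleftrightarrow> (\<exists>\<psi>. eigenfunction v h lam \<psi>)"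

definition kinetic_energy :: "real \<Rightarrow> (real \<Rightarrow> real) \<Rightarrow> real" where
  "kinetic_energy h \<psi> = h\<^sup>2 * (LBINT x. (deriv \<psi> x)\<^sup>2)"

definition K_cl :: "(real \<Rightarrow> real) \<Rightarrow> real \<Rightarrow> real" where
  "K_cl v lam =
     (LBINT x:{x_minus v lam..x_plus v lam}. (lam - v x) powr (1/2)) *
     inverse (LBINT x:{x_minus v lam..x_plus v lam}. (lam - v x) powr (-1/2))"

end

(* Write a = lam - v, P = h^2 psi'^2 + a psi^2 and u = psi psi'. For every multiplier f,
     (f P - h^2 f' u)' = (2 a f' - v' f) psi^2 - h^2 f'' u.
   If 2 a f' - v' f = a - c held in the well with f = c / v' at the turning points, then integrating
   over the well, where the boundary terms c P / v' equal c times the mass outside up to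
   O(h^2 |u|), would give int a psi^2 = c int psi^2, and int a psi^2 over the well is the kinetic
   energy up to O(h^2 |u|). Since 2 a f' - v' f = 2 p (p f)' for p = sqrt a, regularity of f at both
   turning points forces c = K_cl. The multiplier used is f = c f0 + k / (a + e), with f0 linear and
   the second term regularised so that the defect of the equation is O(e) and f'' = O(1/e); with
   e = sqrt h and h^2 u = O(sqrt h) at the turning points the total error is O(sqrt h). Outside the
   well u is monotone, which replaces all decay estimates for psi. *)

theory Submission
  imports Defs
begin

section \<open>Decay in the classically forbidden region\<close>

text \<open>Dividing 2 p (p f)' = a - c by p and integrating over the well gives int p = c int 1/p,
  because p f vanishes at both turning points when f stays bounded there; this is where the quotient
  \<open>K_cl\<close> comes from. The obstacle is the second derivative of the exact multiplier c f0
  + k / a: k'' is only known to be bounded, so f'' is only O(1/a) and may blow up at the turning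
  points. Dividing by a + e instead makes the term h^2 f'' u of size h / e, because h |u| <= (psi^2
  + h^2 psi'^2) / 2; this balances a defect of size e exactly when e = sqrt h. The size of h^2 u at
  a turning point comes from psi^2 = O(1/h) and (h psi')^2 = O(1) there. Uniformity in the spectral
  parameter is organised through one number M >= 1 that controls slopes, curvature, width and
  distance to the level, from above and from below; every constant is a polynomial in M.\<close>

lemma exists_le_mean:
  fixes f :: "real \<Rightarrow> real"
  assumes "a < b" "continuous_on {a..b} f"
  obtains y where "y \<in> {a..b}" "(b - a) * f y \<le> integral {a..b} f"
proof -
  obtain y where y: "y \<in> {a..b}" "\<And>x. x \<in> {a..b} \<Longrightarrow> f y \<le> f x"
    using continuous_attains_inf[of "{a..b}" f] assms by auto
  have "integral {a..b} (\<lambda>_. f y) \<le> integral {a..b} f"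
    by (rule integral_le) (use y assms in \<open>auto intro: integrable_continuous_real\<close>)
  then show ?thesis using that y(1) assms by simp
qed

text \<open>The derivative of u = psi psi' is the energy density, so u increases. A positive value
  of u would keep psi^2 away from 0 on a ray, against square integrability; hence u <= 0 and the
  total energy is lim u - u b <= - u b.\<close>

lemma half_line_energy:
  fixes psi psi1 Q :: "real \<Rightarrow> real"
  assumes d: "\<And>x. (psi has_real_derivative psi1 x) (at x)"
    and d1: "\<And>x. (psi1 has_real_derivative Q x * psi x) (at x)"
    and Q: "continuous_on UNIV Q" "\<And>x. b \<le> x \<Longrightarrow> 0 \<le> Q x"
    and int: "integrable lborel (\<lambda>x. (psi x)\<^sup>2)"
  shows "psi b * psi1 b \<le> 0"
    and "(\<lambda>x. (psi1 x)\<^sup>2 + Q x * (psi x)\<^sup>2) integrable_on {b..}"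
    and "integral {b..} (\<lambda>x. (psi1 x)\<^sup>2 + Q x * (psi x)\<^sup>2) \<le> - (psi b * psi1 b)"
proof -
  define u where "u x = psi x * psi1 x" for x
  define e where "e x = (psi1 x)\<^sup>2 + Q x * (psi x)\<^sup>2" for x
  have du: "(u has_real_derivative e x) (at x)" for x
    unfolding u_def[abs_def] e_def
    by (rule derivative_eq_intros d d1 refl)+ (simp add: power2_eq_square algebra_simps)
  have e0: "0 \<le> e x" if "b \<le> x" for x
    using Q(2)[OF that] by (simp add: e_def)
  have umono: "u x \<le> u y" if "b \<le> x" "x \<le> y" for x y
    by (rule DERIV_nonneg_imp_nondecreasing[OF that(2)]) (use that du e0 in \<open>meson order.trans\<close>)
  have uneg: "u x \<le> 0" if "b \<le> x" for x
  proof (rule ccontr)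
    assume "\<not> u x \<le> 0"
    then have ux: "u x > 0" by simp
    \<comment> \<open>From (psi^2)' = 2 u >= 2 u x the square grows at least linearly after x; the
      constant lower bound from x + 1 on already contradicts integrability.\<close>
    have grow: "2 * u x \<le> (psi y)\<^sup>2" if "x + 1 \<le> y" for y
    proof -
      have "(psi x)\<^sup>2 - 2 * u x * x \<le> (psi y)\<^sup>2 - 2 * u x * y"
      proof (rule DERIV_nonneg_imp_nondecreasing[of x y "\<lambda>z. (psi z)\<^sup>2 - 2 * u x * z"])
        fix z assume "x \<le> z" "z \<le> y"
        have "((\<lambda>z. (psi z)\<^sup>2 - 2 * u x * z) has_real_derivative (2 * u z - 2 * u x)) (at z)"
          unfolding u_def by (rule derivative_eq_intros d refl)+ simp
        then show "\<exists>D. ((\<lambda>z. (psi z)\<^sup>2 - 2 * u x * z) has_real_derivative D) (at z) \<and> 0 \<le> D"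
          using umono[OF \<open>b \<le> x\<close> \<open>x \<le> z\<close>] by (intro exI[of _ "2 * u z - 2 * u x"]) auto
      qed (use that in auto)
      moreover have "2 * u x * 1 \<le> 2 * u x * (y - x)"
        by (rule mult_left_mono) (use that ux in auto)
      ultimately show ?thesis by (simp add: algebra_simps) (smt (verit) zero_le_power2)
    qed
    have "integrable lborel (\<lambda>y. indicator {x+1..} y * (2 * u x) :: real)"
      by (rule Bochner_Integration.integrable_bound[OF int])
        (use grow ux in \<open>auto simp: indicator_def\<close>)
    then have "integrable lborel (\<lambda>y. indicator {x+1..} y * (2 * u x) / (2 * u x) :: real)"
      by (rule integrable_divide)
    then have "integrable lborel (\<lambda>y. indicator {x+1..} y :: real)"
      using ux by simp
    then have "emeasure lborel {x+1..} < \<infinity>"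
      by (simp add: integrable_indicator_iff)
    moreover have "emeasure lborel {x+1..} = \<infinity>"
    proof (rule ccontr)
      assume "emeasure lborel {x+1..} \<noteq> \<infinity>"
      then have f: "emeasure lborel {x+1..} < \<infinity>" by (simp add: top.not_eq_extremum)
      have "real n \<le> measure lborel {x+1..}" for n
      proof -
        have "measure lborel {x+1..x+1+real n} \<le> measure lborel {x+1..}"
          by (rule measure_mono_fmeasurable) (use f in \<open>auto simp: fmeasurable_def\<close>)
        then show ?thesis by simp
      qed
      then show False using reals_Archimedean2[of "measure lborel {x+1..}"] by (meson not_less)
    qed
    ultimately show False by simp
  qed
  show "psi b * psi1 b \<le> 0" using uneg[of b] by (simp add: u_def)
  \<comment> \<open>Only the sign of the limit is used, so it need not be identified as 0.\<close>
  obtain T where T: "(u \<longlongrightarrow> T) at_top" "T \<le> 0"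
  proof -
    define S where "S = (SUP x\<in>{b..}. u x)"
    have bdd: "bdd_above (u ` {b..})" using uneg by (auto simp: bdd_above_def)
    have "(u \<longlongrightarrow> S) at_top"
    proof (rule increasing_tendsto)
      show "\<forall>\<^sub>F x in at_top. u x \<le> S"
        using eventually_ge_at_top[of b] by eventually_elim (auto simp: S_def intro!: cSUP_upper bdd)
      fix l assume "l < S"
      then obtain x where "x \<ge> b" "l < u x"
        unfolding S_def using less_cSUP_iff[OF _ bdd] by fastforce
      then show "\<forall>\<^sub>F x in at_top. l < u x"
        using umono by (intro eventually_mono[OF eventually_ge_at_top[of x]]) (meson less_le_trans)
    qed
    moreover have "S \<le> 0" unfolding S_def by (rule cSUP_least) (use uneg in auto)
    ultimately show ?thesis using that by blast
  qed
  have cpsi: "continuous_on UNIV psi" "continuous_on UNIV psi1"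
    by (auto intro!: continuous_at_imp_continuous_on DERIV_isCont d d1)
  have ce: "continuous_on UNIV e" unfolding e_def[abs_def] by (intro continuous_intros cpsi Q)
  then have me: "e \<in> borel_measurable borel" by (rule borel_measurable_continuous_onI)
  have nn: "(\<integral>\<^sup>+ x. ennreal (e x) * indicator {b..} x \<partial>lborel) = ennreal (T - u b)"
    by (rule nn_integral_FTC_atLeast[OF me _ _ T(1)]) (use du e0 in auto)
  have hb: "has_bochner_integral lborel (\<lambda>x. indicator {b..} x *\<^sub>R e x) (T - u b)"
  proof (rule has_bochner_integral_nn_integral)
    show "(\<lambda>x. indicator {b..} x *\<^sub>R e x) \<in> borel_measurable lborel" using me by simp
    show "AE x in lborel. 0 \<le> indicator {b..} x *\<^sub>R e x" using e0 by (auto simp: indicator_def)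
    have "u b \<le> T" 
      by (rule tendsto_lowerbound[OF T(1)]) (use umono in \<open>auto intro: eventually_mono[OF eventually_ge_at_top[of b]]\<close>)
    then show "0 \<le> T - u b" by simp
    show "(\<integral>\<^sup>+ x. ennreal (indicator {b..} x *\<^sub>R e x) \<partial>lborel) = ennreal (T - u b)"
      unfolding nn[symmetric] by (intro nn_integral_cong) (auto simp: indicator_def)
  qed
  then have si: "set_integrable lborel {b..} e" "(LINT x:{b..}|lborel. e x) = T - u b"
    by (auto simp: set_integrable_def set_lebesgue_integral_def has_bochner_integral_iff)
  show "(\<lambda>x. (psi1 x)\<^sup>2 + Q x * (psi x)\<^sup>2) integrable_on {b..}"
    using set_borel_integral_eq_integral(1)[OF si(1)] by (simp add: e_def[abs_def])
  show "integral {b..} (\<lambda>x. (psi1 x)\<^sup>2 + Q x * (psi x)\<^sup>2) \<le> - (psi b * psi1 b)"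
    using set_borel_integral_eq_integral(2)[OF si(1)] si(2) T(2) by (simp add: e_def[abs_def] u_def)
qed

lemma continuous_dominated_integrable_on:
  fixes f g :: "real \<Rightarrow> real"
  assumes "continuous_on UNIV f" "g integrable_on S" "S \<in> sets lebesgue"
    and "\<And>x. x \<in> S \<Longrightarrow> 0 \<le> f x" "\<And>x. x \<in> S \<Longrightarrow> f x \<le> g x"
  shows "f integrable_on S"
proof (rule measurable_bounded_by_integrable_imp_integrable[OF _ assms(2)])
  show "f \<in> borel_measurable (lebesgue_on S)"
    by (rule measurable_restrict_space1)
      (use borel_measurable_continuous_onI[OF assms(1)] in \<open>simp add: measurable_completion\<close>)
qed (use assms in auto)

text \<open>Here \<open>b\<close> is a right turning point and P' = - V1 psi^2, so P b is the
  integral of V1 psi^2 up to a small remainder. Replacing V1 by V1 b costs M (x - b) <= M^2 (V -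
  lam), which the energy bound of \<open>half_line_energy\<close> absorbs. Thus the boundary term at
  \<open>b\<close> measures the mass beyond it, with an error of the order of
  \<open>e\<close>.\<close>

lemma half_line_balance:
  fixes V V1 psi psi1 :: "real \<Rightarrow> real"
  assumes M: "1 \<le> M" and h: "0 < h"
    and dV: "\<And>x. (V has_real_derivative V1 x) (at x)" and cV1: "continuous_on UNIV V1"
    and lip: "\<And>x. x \<in> {b..B + 1/M} \<Longrightarrow> \<bar>V1 x - V1 b\<bar> \<le> M * (x - b)"
    and near: "\<And>x. x \<in> {b..B + 1/M} \<Longrightarrow> x - b \<le> M * (V x - lam)"
    and far: "\<And>x. B \<le> x \<Longrightarrow> 1 \<le> M * (V x - lam)"
    and b: "V b = lam" "1 \<le> M * V1 b" "b \<le> B"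
    and d: "\<And>x. (psi has_real_derivative psi1 x) (at x)"
    and d1: "\<And>x. (psi1 has_real_derivative (V x - lam) / h\<^sup>2 * psi x) (at x)"
    and int: "integrable lborel (\<lambda>x. (psi x)\<^sup>2)"
  defines "e \<equiv> - (h\<^sup>2 * (psi b * psi1 b))"
  shows "0 \<le> e"
    and "(\<lambda>x. (psi1 x)\<^sup>2) integrable_on {b..}"
    and "h\<^sup>2 * integral {b..} (\<lambda>x. (psi1 x)\<^sup>2) \<le> e"
    and "\<bar>h\<^sup>2 * (psi1 b)\<^sup>2 / V1 b - integral {b..} (\<lambda>x. (psi x)\<^sup>2)\<bar> \<le> 3 * M ^ 3 * e"
proof -
  define q where "q x = V x - lam" for x
  define E where "E x = h\<^sup>2 * (psi1 x)\<^sup>2 + q x * (psi x)\<^sup>2" for x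
  have cont: "continuous_on S V" "continuous_on S psi" "continuous_on S psi1" "continuous_on S V1" for S
    by (auto intro!: continuous_at_imp_continuous_on DERIV_isCont[OF d] DERIV_isCont[OF d1]
        DERIV_isCont[OF dV] simp: cV1[unfolded continuous_on_eq_continuous_at[OF open_UNIV]])
  note cint = integrable_continuous_real
  have q0: "0 \<le> q x" if "b \<le> x" for x
  proof (cases "x \<le> B")
    case True
    have "0 \<le> M * q x" using near[of x] that True M by (simp add: q_def) (smt (verit) divide_nonneg_nonneg)
    then show ?thesis using M by (simp add: zero_le_mult_iff)
  next
    case False
    then have "0 \<le> M * q x" using far[of x] by (simp add: q_def)
    then show ?thesis using M by (simp add: zero_le_mult_iff)
  qed
  have Eeq: "E x = h\<^sup>2 * ((psi1 x)\<^sup>2 + q x / h\<^sup>2 * (psi x)\<^sup>2)" for x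
    using h by (simp add: E_def field_simps)
  have cQ: "continuous_on UNIV (\<lambda>x. q x / h\<^sup>2)"
    unfolding q_def[abs_def] by (intro continuous_intros cont) (use h in auto)
  have Q0: "0 \<le> q x / h\<^sup>2" if "b \<le> x" for x
    using q0[OF that] by simp
  note hl = half_line_energy[of psi psi1 "\<lambda>x. q x / h\<^sup>2", OF d _ cQ Q0 int, of b]
  show e0: "0 \<le> e" using hl(1) d1 h unfolding e_def q_def by (simp add: mult_le_0_iff)
  have intE: "E integrable_on {b..}" and E_le: "integral {b..} E \<le> e"
  proof -
    show "E integrable_on {b..}"
      unfolding Eeq[abs_def] using hl(2) d1 by (intro integrable_on_mult_right) (simp add: q_def)
    have "integral {b..} E = h\<^sup>2 * integral {b..} (\<lambda>x. (psi1 x)\<^sup>2 + q x / h\<^sup>2 * (psi x)\<^sup>2)"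
      unfolding Eeq[abs_def] by simp
    also have "\<dots> \<le> h\<^sup>2 * (- (psi b * psi1 b))"
      by (rule mult_left_mono) (use hl(3) d1 in \<open>auto simp: q_def\<close>)
    finally show "integral {b..} E \<le> e" by (simp add: e_def)
  qed
  have cE: "continuous_on S E" for S
    unfolding E_def[abs_def] q_def by (intro continuous_intros cont)
  have E0: "0 \<le> E x" if "b \<le> x" for x
    using q0[OF that] by (simp add: E_def)
  have subE: "E integrable_on S \<and> integral S E \<le> e" if "S \<subseteq> {b..}" "S \<in> sets lebesgue" for S
  proof -
    have "E absolutely_integrable_on {b..}"
      by (rule nonnegative_absolutely_integrable_1[OF intE]) (use E0 in auto)
    then have "E absolutely_integrable_on S" by (rule set_integrable_subset) (use that in auto)
    then have i: "E integrable_on S" by (simp add: absolutely_integrable_on_def)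
    have "integral S E \<le> integral {b..} E"
      by (rule integral_subset_le) (use i intE that E0 in auto)
    then show ?thesis using i E_le by simp
  qed
  show i1: "(\<lambda>x. (psi1 x)\<^sup>2) integrable_on {b..}"
  proof -
    have "(\<lambda>x. h\<^sup>2 * (psi1 x)\<^sup>2) integrable_on {b..}"
      by (rule continuous_dominated_integrable_on[OF _ intE])
        (use q0 in \<open>auto intro!: continuous_intros cont simp: E_def\<close>)
    then show ?thesis using h by (simp add: integrable_on_cmult_iff)
  qed
  have "integral {b..} (\<lambda>x. h\<^sup>2 * (psi1 x)\<^sup>2) \<le> integral {b..} E"
    by (rule integral_le) (use q0 intE i1 in \<open>auto simp: E_def intro: integrable_on_mult_right\<close>)
  then show "h\<^sup>2 * integral {b..} (\<lambda>x. (psi1 x)\<^sup>2) \<le> e" using E_le by simp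

  have iU: "(\<lambda>x. (psi x)\<^sup>2) integrable_on UNIV" using integrable_on_lborel[OF int] .
  have ipsi: "(\<lambda>x. (psi x)\<^sup>2) integrable_on S" if "S \<in> sets lebesgue" for S
  proof -
    have "(\<lambda>x. (psi x)\<^sup>2) absolutely_integrable_on S"
      by (rule set_integrable_subset[OF nonnegative_absolutely_integrable_1[OF iU]]) (use that in auto)
    then show ?thesis by (simp add: absolutely_integrable_on_def)
  qed
  define P where "P x = h\<^sup>2 * (psi1 x)\<^sup>2 - q x * (psi x)\<^sup>2" for x
  have dP: "(P has_real_derivative - V1 x * (psi x)\<^sup>2) (at x)" for x
    unfolding P_def q_def
    by (rule derivative_eq_intros d d1 dV refl)+ (use h in \<open>simp add: field_simps power2_eq_square\<close>)
  \<comment> \<open>V1 is controlled only up to \<open>B + 1/M\<close>, so the balance is cut off at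
    a point Y where P is small. Such a point exists because |P| is dominated by the energy density,
    whose integral over this interval of length 1/M is at most \<open>e\<close>.\<close>
  obtain Y where Y: "Y \<in> {B..B + 1/M}" "1/M * \<bar>P Y\<bar> \<le> integral {B..B + 1/M} (\<lambda>x. \<bar>P x\<bar>)"
  proof -
    have "continuous_on {B..B + 1/M} (\<lambda>x. \<bar>P x\<bar>)"
      unfolding P_def q_def by (intro continuous_intros cont)
    from exists_le_mean[OF _ this] that M show ?thesis by auto
  qed
  have bY: "b \<le> Y" using Y b by auto
  have PY: "\<bar>P Y\<bar> \<le> M * e"
  proof -
    have "integral {B..B + 1/M} (\<lambda>x. \<bar>P x\<bar>) \<le> integral {B..B + 1/M} E"
    proof (rule integral_le)
      show "(\<lambda>x. \<bar>P x\<bar>) integrable_on {B..B + 1/M}"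
        unfolding P_def q_def by (intro cint continuous_intros cont)
      show "E integrable_on {B..B + 1/M}" by (intro cint cE)
      fix x assume "x \<in> {B..B + 1/M}"
      then have "0 \<le> q x * (psi x)\<^sup>2" using q0[of x] b by simp
      then show "\<bar>P x\<bar> \<le> E x" unfolding P_def E_def by (smt (verit) zero_le_power2 mult_nonneg_nonneg)
    qed
    also have "\<dots> \<le> e" using subE[of "{B..B+1/M}"] b by auto
    finally have "1/M * \<bar>P Y\<bar> \<le> e" using Y(2) by linarith
    then show ?thesis using M by (simp add: field_simps)
  qed
  have ftc: "P Y - P b = integral {b..Y} (\<lambda>x. - V1 x * (psi x)\<^sup>2)"
    by (rule integral_unique[symmetric] fundamental_theorem_of_calculus bY)+
      (use dP in \<open>auto simp: has_real_derivative_iff_has_vector_derivative[symmetric]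
        intro: has_field_derivative_at_within\<close>)
  have Vb: "V1 b > 0" using b(2) M by (smt (verit) mult_nonneg_nonpos)
  have invV: "1 / V1 b \<le> M" using b(2) Vb by (simp add: field_simps)
  have Pb: "P b = h\<^sup>2 * (psi1 b)\<^sup>2" by (simp add: P_def q_def b)
  have split: "integral {b..} (\<lambda>x. (psi x)\<^sup>2) = integral {b..Y} (\<lambda>x. (psi x)\<^sup>2) + integral {Y..} (\<lambda>x. (psi x)\<^sup>2)"
  proof -
    have eq: "{b..} = {b..Y} \<union> {Y..}" using bY by auto
    show ?thesis unfolding eq
      by (rule integral_Un) (auto intro!: ipsi negligible_subset[OF negligible_sing[of Y]])
  qed
  have tail: "integral {Y..} (\<lambda>x. (psi x)\<^sup>2) \<le> M * e"
  proof -
    have "integral {Y..} (\<lambda>x. (psi x)\<^sup>2) \<le> integral {Y..} (\<lambda>x. M * E x)"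
    proof (rule integral_le)
      show "(\<lambda>x. (psi x)\<^sup>2) integrable_on {Y..}" by (rule ipsi) auto
      show "(\<lambda>x. M * E x) integrable_on {Y..}"
        using subE[of "{Y..}"] bY by (auto intro: integrable_on_mult_right)
      fix x assume "x \<in> {Y..}"
      then have "1 \<le> M * q x" using far[of x] Y by (simp add: q_def)
      then have "1 * (psi x)\<^sup>2 \<le> M * q x * (psi x)\<^sup>2" by (rule mult_right_mono) simp
      also have "\<dots> \<le> M * E x" using M h by (simp add: E_def algebra_simps)
      finally show "(psi x)\<^sup>2 \<le> M * E x" by simp
    qed
    also have "\<dots> = M * integral {Y..} E" by simp
    also have "\<dots> \<le> M * e" using subE[of "{Y..}"] bY M by (intro mult_left_mono) auto
    finally show ?thesis .
  qed
  have tail0: "0 \<le> integral {Y..} (\<lambda>x. (psi x)\<^sup>2)" by (rule integral_nonneg) (auto intro: ipsi)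
  \<comment> \<open>The cost of freezing V1 at \<open>b\<close>. The factor M^3 consists of M^2 from
    \<open>lip\<close> and \<open>near\<close>, and M from the division by V1 b.\<close>
  define D where "D = integral {b..Y} (\<lambda>x. V1 x / V1 b * (psi x)\<^sup>2 - (psi x)\<^sup>2)"
  have D: "\<bar>D\<bar> \<le> M ^ 3 * e"
  proof -
    have "norm D \<le> integral {b..Y} (\<lambda>x. M ^ 3 * E x)"
      unfolding D_def
    proof (rule integral_norm_bound_integral)
      show "(\<lambda>x. V1 x / V1 b * (psi x)\<^sup>2 - (psi x)\<^sup>2) integrable_on {b..Y}"
        using Vb by (intro cint continuous_intros cont) auto
      show "(\<lambda>x. M ^ 3 * E x) integrable_on {b..Y}" by (intro cint continuous_intros cE)
      fix x assume x: "x \<in> {b..Y}"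
      then have xB: "x \<in> {b..B + 1/M}" using Y by auto
      have "\<bar>V1 x / V1 b - 1\<bar> = \<bar>V1 x - V1 b\<bar> * (1 / V1 b)"
      proof -
        have "V1 x / V1 b - 1 = (V1 x - V1 b) * (1 / V1 b)"
          using Vb by (simp add: diff_divide_distrib)
        then show ?thesis using Vb by (simp only: abs_mult) simp
      qed
      also have "\<dots> \<le> (M * (x - b)) * M"
        by (rule mult_mono[OF lip[OF xB] invV]) (use M x Vb in auto)
      also have "\<dots> \<le> (M * (M * q x)) * M"
        using near[OF xB] M by (intro mult_right_mono mult_left_mono) (auto simp: q_def)
      finally have 1: "\<bar>V1 x / V1 b - 1\<bar> \<le> M ^ 3 * q x" by (simp add: power3_eq_cube mult_ac)
      have "norm (V1 x / V1 b * (psi x)\<^sup>2 - (psi x)\<^sup>2) = \<bar>V1 x / V1 b - 1\<bar> * (psi x)\<^sup>2"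
      proof -
        have "V1 x / V1 b * (psi x)\<^sup>2 - (psi x)\<^sup>2 = (V1 x / V1 b - 1) * (psi x)\<^sup>2"
          by (simp only: left_diff_distrib mult_1)
        then show ?thesis by (simp only: real_norm_def abs_mult abs_power2)
      qed
      also have "\<dots> \<le> M ^ 3 * q x * (psi x)\<^sup>2" by (rule mult_right_mono[OF 1]) simp
      also have "\<dots> \<le> M ^ 3 * E x" using M by (simp add: E_def algebra_simps)
      finally show "norm (V1 x / V1 b * (psi x)\<^sup>2 - (psi x)\<^sup>2) \<le> M ^ 3 * E x" .
    qed
    also have "\<dots> = M ^ 3 * integral {b..Y} E" by simp
    also have "\<dots> \<le> M ^ 3 * e" using subE[of "{b..Y}"] M by (intro mult_left_mono) auto
    finally show ?thesis by simp
  qed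
  have Deq: "D = (P b - P Y) / V1 b - integral {b..Y} (\<lambda>x. (psi x)\<^sup>2)"
  proof -
    have "D = integral {b..Y} (\<lambda>x. V1 x / V1 b * (psi x)\<^sup>2) - integral {b..Y} (\<lambda>x. (psi x)\<^sup>2)"
      unfolding D_def using Vb
      by (intro Henstock_Kurzweil_Integration.integral_diff cint continuous_intros cont) auto
    also have "(\<lambda>x. V1 x / V1 b * (psi x)\<^sup>2) = (\<lambda>x. - (1 / V1 b) * (- V1 x * (psi x)\<^sup>2))" by auto
    also have "integral {b..Y} \<dots> = - (1 / V1 b) * (P Y - P b)"
      unfolding ftc by (rule integral_mult_right)
    finally show ?thesis by (simp add: diff_divide_distrib)
  qed
  have "h\<^sup>2 * (psi1 b)\<^sup>2 / V1 b - integral {b..} (\<lambda>x. (psi x)\<^sup>2)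
      = P Y / V1 b + D - integral {Y..} (\<lambda>x. (psi x)\<^sup>2)"
    unfolding Deq split Pb[symmetric] by (simp add: diff_divide_distrib)
  moreover have "\<bar>P Y / V1 b\<bar> \<le> M * (M * e)"
  proof -
    have "\<bar>P Y / V1 b\<bar> = (1 / V1 b) * \<bar>P Y\<bar>" using Vb by simp
    also have "\<dots> \<le> M * (M * e)" by (rule mult_mono[OF invV PY]) (use M in auto)
    finally show ?thesis .
  qed
  moreover have "M * (M * e) \<le> M ^ 3 * e"
    using mult_right_mono[OF power_increasing[of 2 3 M] e0] M by (simp add: power2_eq_square mult_ac)
  moreover have "M * e \<le> M ^ 3 * e"
    using M e0 power_increasing[of 1 3 M] by (intro mult_right_mono) auto
  ultimately show "\<bar>h\<^sup>2 * (psi1 b)\<^sup>2 / V1 b - integral {b..} (\<lambda>x. (psi x)\<^sup>2)\<bar> \<le> 3 * M ^ 3 * e"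
    using D tail tail0 by linarith
qed

section \<open>The energy balance over the well\<close>

lemma has_integral_real_derivative_interior:
  fixes F f :: "real \<Rightarrow> real"
  assumes "a \<le> b" "continuous_on {a..b} F"
    and "\<And>x. x \<in> {a<..<b} \<Longrightarrow> (F has_real_derivative f x) (at x)"
  shows "(f has_integral F b - F a) {a..b}"
  by (rule fundamental_theorem_of_calculus_interior)
    (use assms in \<open>auto simp: has_real_derivative_iff_has_vector_derivative[symmetric]\<close>)

text \<open>The weight x - l vanishes at l, so integrating the derivatives of (x - l) P and (x - l)
  psi^2 expresses the values at r by integrals over the well. The first gives (h psi')^2 = O(1), as
  P r has no potential part. The second, with h |psi psi'| <= (psi^2 + h^2 psi'^2) / 2, gives psi^2
  = O(1/h). The product of the two bounds yields the claim.\<close>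

lemma endpoint_bound:
  fixes V V1 psi psi1 :: "real \<Rightarrow> real"
  assumes M: "1 \<le> M" and h: "0 < h" "h \<le> 1"
    and dV: "\<And>x. (V has_real_derivative V1 x) (at x)" and cV1: "continuous_on UNIV V1"
    and lr: "1 \<le> M * (r - l)" "r - l \<le> M"
    and V1: "\<And>x. x \<in> {l..r} \<Longrightarrow> \<bar>V1 x\<bar> \<le> M"
    and V: "\<And>x. x \<in> {l..r} \<Longrightarrow> lam - V x \<le> M\<^sup>2" "V r = lam"
    and d: "\<And>x. (psi has_real_derivative psi1 x) (at x)"
    and d1: "\<And>x. (psi1 has_real_derivative (V x - lam) / h\<^sup>2 * psi x) (at x)"
    and mass: "integral {l..r} (\<lambda>x. (psi x)\<^sup>2) \<le> 1"
    and kin: "h\<^sup>2 * integral {l..r} (\<lambda>x. (psi1 x)\<^sup>2) \<le> M\<^sup>2"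
  shows "\<bar>h\<^sup>2 * (psi r * psi1 r)\<bar> \<le> 3 * M ^ 4 * sqrt h"
proof -
  have cont: "continuous_on S V" "continuous_on S psi" "continuous_on S psi1" "continuous_on S V1" for S
    by (auto intro!: continuous_at_imp_continuous_on DERIV_isCont[OF d] DERIV_isCont[OF d1]
        DERIV_isCont[OF dV] simp: cV1[unfolded continuous_on_eq_continuous_at[OF open_UNIV]])
  note cint = integrable_continuous_real
  have "0 < M * (r - l)" using lr by linarith
  then have lr0: "l < r" using M by (simp add: zero_less_mult_iff)
  define m where "m = integral {l..r} (\<lambda>x. (psi x)\<^sup>2)"
  define k where "k = integral {l..r} (\<lambda>x. (psi1 x)\<^sup>2)"
  have im: "((\<lambda>x. (psi x)\<^sup>2) has_integral m) {l..r}" and ik: "((\<lambda>x. (psi1 x)\<^sup>2) has_integral k) {l..r}"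
    unfolding m_def k_def by (intro integrable_integral cint continuous_intros cont)+
  have m1: "m \<le> 1" and k1: "h\<^sup>2 * k \<le> M\<^sup>2" using mass kin by (auto simp: m_def k_def)
  have M2: "1 \<le> M\<^sup>2" using M by simp
  define P where "P x = h\<^sup>2 * (psi1 x)\<^sup>2 + (lam - V x) * (psi x)\<^sup>2" for x
  have dP: "((\<lambda>x. (x - l) * P x) has_real_derivative P x + (x - l) * (- V1 x * (psi x)\<^sup>2)) (at x)" for x
    unfolding P_def
    by (rule derivative_eq_intros d d1 dV refl)+ (use h in \<open>simp add: field_simps power2_eq_square\<close>)
  have dpsi: "((\<lambda>x. (x - l) * (psi x)\<^sup>2) has_real_derivative (psi x)\<^sup>2 + (x - l) * (2 * (psi x * psi1 x))) (at x)" for x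
    by (rule derivative_eq_intros d refl)+ (simp add: field_simps power2_eq_square)
  have "(r - l) * P r \<le> h\<^sup>2 * k + 2 * M\<^sup>2 * m"
  proof (rule has_integral_le)
    show "((\<lambda>x. P x + (x - l) * (- V1 x * (psi x)\<^sup>2)) has_integral (r - l) * P r) {l..r}"
      using has_integral_real_derivative_interior[OF less_imp_le[OF lr0] _ dP] DERIV_isCont[OF dP]
      by (simp add: continuous_at_imp_continuous_on)
    show "((\<lambda>x. h\<^sup>2 * (psi1 x)\<^sup>2 + 2 * M\<^sup>2 * (psi x)\<^sup>2) has_integral h\<^sup>2 * k + 2 * M\<^sup>2 * m) {l..r}"
      by (intro has_integral_add has_integral_mult_right im ik)
    fix x assume x: "x \<in> {l..r}"
    have "(x - l) * (- V1 x) \<le> (x - l) * M"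
      by (rule mult_left_mono) (use V1[OF x] x in auto)
    also have "\<dots> \<le> M * M" by (rule mult_right_mono) (use x lr M in auto)
    finally have "(x - l) * (- V1 x) \<le> M * M" .
    then have "(lam - V x + (x - l) * (- V1 x)) * (psi x)\<^sup>2 \<le> (2 * M\<^sup>2) * (psi x)\<^sup>2"
      using V(1)[OF x] by (intro mult_right_mono) (auto simp: power2_eq_square)
    then show "P x + (x - l) * (- V1 x * (psi x)\<^sup>2) \<le> h\<^sup>2 * (psi1 x)\<^sup>2 + 2 * M\<^sup>2 * (psi x)\<^sup>2"
      by (simp add: P_def algebra_simps)
  qed
  also have "\<dots> \<le> 3 * M\<^sup>2" using m1 k1 mult_left_mono[OF m1, of "2 * M\<^sup>2"] by simp
  finally have 1: "(r - l) * (h * psi1 r)\<^sup>2 \<le> 3 * M\<^sup>2" by (simp add: P_def V(2) power_mult_distrib)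
  have *: "y \<le> M * z" if "(r - l) * y \<le> z" "0 \<le> y" for y z
  proof -
    have "1 * y \<le> (M * (r - l)) * y" by (rule mult_right_mono) (use lr that in auto)
    also have "\<dots> = M * ((r - l) * y)" by simp
    also have "\<dots> \<le> M * z" by (rule mult_left_mono) (use that M in auto)
    finally show ?thesis by simp
  qed
  have A1: "(h * psi1 r)\<^sup>2 \<le> 3 * M ^ 3"
    using *[OF 1 zero_le_power2] by (simp add: power2_eq_square power3_eq_cube mult_ac)
  have "(r - l) * (psi r)\<^sup>2 \<le> (1 + M / h) * m + M / h * (h\<^sup>2 * k)"
  proof (rule has_integral_le)
    show "((\<lambda>x. (psi x)\<^sup>2 + (x - l) * (2 * (psi x * psi1 x))) has_integral (r - l) * (psi r)\<^sup>2) {l..r}"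
      using has_integral_real_derivative_interior[OF less_imp_le[OF lr0] _ dpsi] DERIV_isCont[OF dpsi]
      by (simp add: continuous_at_imp_continuous_on)
    show "((\<lambda>x. (1 + M / h) * (psi x)\<^sup>2 + M / h * (h\<^sup>2 * (psi1 x)\<^sup>2)) has_integral
        (1 + M / h) * m + M / h * (h\<^sup>2 * k)) {l..r}"
      by (intro has_integral_add has_integral_mult_right im ik)
    fix x assume x: "x \<in> {l..r}"
    have "0 \<le> (psi x - h * psi1 x)\<^sup>2" by simp
    then have am: "h * (2 * (psi x * psi1 x)) \<le> (psi x)\<^sup>2 + h\<^sup>2 * (psi1 x)\<^sup>2"
      by (simp add: power2_eq_square algebra_simps)
    have "h * ((x - l) * (2 * (psi x * psi1 x))) = (x - l) * (h * (2 * (psi x * psi1 x)))" by simp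
    also have "\<dots> \<le> (x - l) * ((psi x)\<^sup>2 + h\<^sup>2 * (psi1 x)\<^sup>2)"
      by (rule mult_left_mono[OF am]) (use x in auto)
    also have "\<dots> \<le> M * ((psi x)\<^sup>2 + h\<^sup>2 * (psi1 x)\<^sup>2)"
      by (rule mult_right_mono) (use x lr in auto)
    finally have "(x - l) * (2 * (psi x * psi1 x)) \<le> M / h * ((psi x)\<^sup>2 + h\<^sup>2 * (psi1 x)\<^sup>2)"
      using h by (simp add: pos_le_divide_eq mult.commute)
    then show "(psi x)\<^sup>2 + (x - l) * (2 * (psi x * psi1 x)) \<le> (1 + M / h) * (psi x)\<^sup>2 + M / h * (h\<^sup>2 * (psi1 x)\<^sup>2)"
      by (simp add: algebra_simps)
  qed
  also have "\<dots> \<le> (1 + M / h) * 1 + M / h * M\<^sup>2"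
    by (intro add_mono mult_left_mono m1 k1) (use M h in auto)
  also have "\<dots> \<le> 3 * M ^ 3 / h"
  proof -
    have "h + M + M * M\<^sup>2 \<le> 3 * M ^ 3"
    proof -
      have "1 \<le> M ^ 3" by (rule one_le_power[OF M])
      moreover have "M \<le> M ^ 3" using power_increasing[of 1 3 M, OF _ M] by simp
      moreover have "M * M\<^sup>2 = M ^ 3" by (simp add: power2_eq_square power3_eq_cube)
      ultimately show ?thesis using h by linarith
    qed
    then have "(h + M + M * M\<^sup>2) / h \<le> 3 * M ^ 3 / h" by (rule divide_right_mono) (use h in simp)
    then show ?thesis using h by (simp add: add_divide_distrib)
  qed
  finally have A2: "(psi r)\<^sup>2 \<le> M * (3 * M ^ 3 / h)" by (rule *) simp
  have "(h\<^sup>2 * (psi r * psi1 r))\<^sup>2 = h\<^sup>2 * (psi r)\<^sup>2 * (h * psi1 r)\<^sup>2"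
    by (simp add: power_mult_distrib power2_eq_square)
  also have "\<dots> \<le> h\<^sup>2 * (M * (3 * M ^ 3 / h)) * (3 * M ^ 3)"
    by (intro mult_mono A1 A2 mult_nonneg_nonneg) (use M h in auto)
  also have "\<dots> = 9 * M ^ 7 * h"
    using h by (simp add: field_simps power2_eq_square eval_nat_numeral)
  \<comment> \<open>The exponent is raised to an even one so that the bound is a perfect
    square.\<close>
  also have "\<dots> \<le> 9 * M ^ 8 * h"
    using M h power_increasing[of 7 8 M] by simp
  also have "\<dots> = (3 * M ^ 4 * sqrt h)\<^sup>2"
    using h by (simp add: power_mult_distrib flip: power_mult)
  finally show ?thesis using abs_le_square_iff[of "h\<^sup>2 * (psi r * psi1 r)" "3 * M ^ 4 * sqrt h"] M h
    by simp
qed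

text \<open>The multiplier enters only through \<open>f\<close>, \<open>f1\<close>,
  \<open>f2\<close> and their bounds; the factors \<open>sqrt h\<close> in \<open>fODE\<close> and
  \<open>f2\<close> anticipate e = sqrt h. Contributions of the left half line come from the right
  one by the reflection x -> -x.\<close>

lemma well_balance:
  fixes V V1 psi psi1 f f1 f2 :: "real \<Rightarrow> real"
  assumes M: "1 \<le> M" and h: "0 < h" "h \<le> 1"
    and dV: "\<And>x. (V has_real_derivative V1 x) (at x)" and cV1: "continuous_on UNIV V1"
    and width: "1 \<le> M * (r - l)" "r - l \<le> M"
    and V1: "\<And>x. x \<in> {l..r} \<Longrightarrow> \<bar>V1 x\<bar> \<le> M"
    and V: "\<And>x. x \<in> {l..r} \<Longrightarrow> 0 \<le> lam - V x" "\<And>x. x \<in> {l..r} \<Longrightarrow> lam - V x \<le> M\<^sup>2"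
    and turn: "V l = lam" "V r = lam" "1 \<le> M * V1 r" "1 \<le> M * (- V1 l)"
    and lipr: "\<And>x. x \<in> {r..B + 1/M} \<Longrightarrow> \<bar>V1 x - V1 r\<bar> \<le> M * (x - r)"
    and nearr: "\<And>x. x \<in> {r..B + 1/M} \<Longrightarrow> x - r \<le> M * (V x - lam)"
    and farr: "\<And>x. B \<le> x \<Longrightarrow> 1 \<le> M * (V x - lam)"
    and lipl: "\<And>x. x \<in> {A - 1/M..l} \<Longrightarrow> \<bar>V1 x - V1 l\<bar> \<le> M * (l - x)"
    and nearl: "\<And>x. x \<in> {A - 1/M..l} \<Longrightarrow> l - x \<le> M * (V x - lam)"
    and farl: "\<And>x. x \<le> A \<Longrightarrow> 1 \<le> M * (V x - lam)"
    and AB: "A \<le> l" "r \<le> B"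
    and d: "\<And>x. (psi has_real_derivative psi1 x) (at x)"
    and d1: "\<And>x. (psi1 has_real_derivative (V x - lam) / h\<^sup>2 * psi x) (at x)"
    and int: "integrable lborel (\<lambda>x. (psi x)\<^sup>2)" "(LBINT x. (psi x)\<^sup>2) = 1"
    and K: "0 \<le> c" "c \<le> K"
    and f: "continuous_on {l..r} f" "continuous_on {l..r} f1"
      "\<And>x. x \<in> {l<..<r} \<Longrightarrow> (f has_real_derivative f1 x) (at x)"
      "\<And>x. x \<in> {l<..<r} \<Longrightarrow> (f1 has_real_derivative f2 x) (at x)"
    and fend: "f l = c / V1 l" "f r = c / V1 r" "\<bar>f1 l\<bar> \<le> K" "\<bar>f1 r\<bar> \<le> K"
    and fODE: "\<And>x. x \<in> {l<..<r} \<Longrightarrow>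
      \<bar>2 * (lam - V x) * f1 x - V1 x * f x - ((lam - V x) - c)\<bar> \<le> K * sqrt h"
    and f2: "\<And>x. x \<in> {l<..<r} \<Longrightarrow> \<bar>f2 x\<bar> \<le> K / sqrt h"
  shows "integrable lborel (\<lambda>x. (psi1 x)\<^sup>2)"
    and "\<bar>h\<^sup>2 * (LBINT x. (psi1 x)\<^sup>2) - c\<bar>
      \<le> (K * (1 + M\<^sup>2) + (K + 3 * K * M ^ 3 + 1) * (6 * M ^ 4)) * sqrt h"
proof -
  have cont: "continuous_on S V" "continuous_on S psi" "continuous_on S psi1" "continuous_on S V1" for S
    by (auto intro!: continuous_at_imp_continuous_on DERIV_isCont[OF d] DERIV_isCont[OF d1]
        DERIV_isCont[OF dV] simp: cV1[unfolded continuous_on_eq_continuous_at[OF open_UNIV]])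
  note cint = integrable_continuous_real
  have "0 < M * (r - l)" using width by linarith
  then have lr: "l < r" using M by (simp add: zero_less_mult_iff)
  define er where "er = - (h\<^sup>2 * (psi r * psi1 r))"
  define el where "el = h\<^sup>2 * (psi l * psi1 l)"
  note right = half_line_balance[OF M h(1) dV cV1 lipr nearr farr turn(2,3) AB(2) d d1 int(1), folded er_def]

  \<comment> \<open>Nonnegativity upgrades integrability to absolute integrability, for which the
    change of variables is available. The disjunction allows integrability to be known on either
    side.\<close>
  have refl_int: "(\<lambda>x. g (-x)) integrable_on {-l..} \<longleftrightarrow> g integrable_on {..l}"
    "integral {-l..} (\<lambda>x. g (-x)) = integral {..l} g"
    if "\<And>x. 0 \<le> g x" "(\<lambda>x. g (-x)) integrable_on {-l..} \<or> g integrable_on {..l}" for g :: "real \<Rightarrow> real"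
  proof -
    have ai: "(\<lambda>x. g (-x)) absolutely_integrable_on {-l..} \<longleftrightarrow> (\<lambda>x. g (-x)) integrable_on {-l..}"
      "g absolutely_integrable_on {..l} \<longleftrightarrow> g integrable_on {..l}"
      using that(1) by (auto simp: absolutely_integrable_on_def)
    note R = has_absolute_integral_reflect_real[of "{-l..}" "{..l}" g]
    have R': "(\<lambda>x. g (-x)) absolutely_integrable_on {-l..} \<and> integral {-l..} (\<lambda>x. g (-x)) = b \<longleftrightarrow>
         g absolutely_integrable_on {..l} \<and> integral {..l} g = b" for b
      by (rule R) auto
    then show "(\<lambda>x. g (-x)) integrable_on {-l..} \<longleftrightarrow> g integrable_on {..l}"
      "integral {-l..} (\<lambda>x. g (-x)) = integral {..l} g"
      using that(2) unfolding ai by blast+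
  qed
  define U where "U x = V (-x)" for x
  define U1 where "U1 x = - V1 (-x)" for x
  define phi where "phi x = psi (-x)" for x
  define phi1 where "phi1 x = - psi1 (-x)" for x
  have dU: "(U has_real_derivative U1 x) (at x)" for x
    unfolding U_def[abs_def] U1_def by (rule DERIV_mirror[THEN iffD1, OF dV])
  have cU1: "continuous_on UNIV U1"
    unfolding U1_def[abs_def] by (intro continuous_intros continuous_on_compose2[OF cV1]) auto
  have dphi: "(phi has_real_derivative phi1 x) (at x)" for x
    unfolding phi_def[abs_def] phi1_def by (rule DERIV_mirror[THEN iffD1, OF d])
  have dphi1: "(phi1 has_real_derivative (U x - lam) / h\<^sup>2 * phi x) (at x)" for x
    unfolding phi_def phi1_def[abs_def] U_def
    using DERIV_minus[OF DERIV_mirror[THEN iffD1, OF d1]] by simp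
  have iphi: "integrable lborel (\<lambda>x. (phi x)\<^sup>2)"
    unfolding phi_def using lborel_integrable_real_affine[OF int(1), of "-1" 0] by simp
  have L: "0 \<le> - (h\<^sup>2 * (phi (-l) * phi1 (-l)))"
     "(\<lambda>x. (phi1 x)\<^sup>2) integrable_on {-l..}"
     "h\<^sup>2 * integral {-l..} (\<lambda>x. (phi1 x)\<^sup>2) \<le> - (h\<^sup>2 * (phi (-l) * phi1 (-l)))"
     "\<bar>h\<^sup>2 * (phi1 (-l))\<^sup>2 / U1 (-l) - integral {-l..} (\<lambda>x. (phi x)\<^sup>2)\<bar> \<le> 3 * M ^ 3 * - (h\<^sup>2 * (phi (-l) * phi1 (-l)))"
  proof (atomize (full), goal_cases)
    case 1
    have 1: "\<bar>U1 x - U1 (-l)\<bar> \<le> M * (x - - l)" if "x \<in> {-l..- A + 1/M}" for x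
      using lipl[of "-x"] that by (simp add: U1_def) (smt (verit))
    have 2: "x - - l \<le> M * (U x - lam)" if "x \<in> {-l..- A + 1/M}" for x
      using nearl[of "-x"] that by (simp add: U_def)
    have 3: "1 \<le> M * (U x - lam)" if "- A \<le> x" for x
      using farl[of "-x"] that by (simp add: U_def)
    have 4: "U (-l) = lam" "1 \<le> M * U1 (-l)" "- l \<le> - A" using turn AB by (auto simp: U_def U1_def)
    from half_line_balance[OF M h(1) dU cU1 1 2 3 4 dphi dphi1 iphi] show ?case by auto
  qed
  have iU: "(\<lambda>x. (psi x)\<^sup>2) integrable_on UNIV" using integrable_on_lborel[OF int(1)] .
  have ipsi: "(\<lambda>x. (psi x)\<^sup>2) integrable_on S" if "S \<in> sets lebesgue" for S
  proof -
    have "(\<lambda>x. (psi x)\<^sup>2) absolutely_integrable_on S"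
      by (rule set_integrable_subset[OF nonnegative_absolutely_integrable_1[OF iU]]) (use that in auto)
    then show ?thesis by (simp add: absolutely_integrable_on_def)
  qed
  have phiint: "integral {-l..} (\<lambda>x. (phi x)\<^sup>2) = integral {..l} (\<lambda>x. (psi x)\<^sup>2)"
    unfolding phi_def by (rule refl_int(2)) (auto intro: ipsi)
  have phi1int: "(\<lambda>x. (psi1 x)\<^sup>2) integrable_on {..l}"
    "integral {-l..} (\<lambda>x. (phi1 x)\<^sup>2) = integral {..l} (\<lambda>x. (psi1 x)\<^sup>2)"
    using refl_int[of "\<lambda>x. (psi1 x)\<^sup>2"] L(2) by (auto simp: phi1_def)
  have phiend: "- (h\<^sup>2 * (phi (-l) * phi1 (-l))) = el" "(phi1 (-l))\<^sup>2 = (psi1 l)\<^sup>2" "U1 (-l) = - V1 l"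
    by (auto simp: el_def phi_def phi1_def U1_def)
  note left = L[unfolded phiint phi1int(2) phiend]

  have split: "g integrable_on UNIV \<and> integral UNIV g = integral {..l} g + integral {l..r} g + integral {r..} g"
    if "g integrable_on {..l}" "g integrable_on {l..r}" "g integrable_on {r..}" for g :: "real \<Rightarrow> real"
  proof -
    have 1: "(g has_integral integral {..l} g + integral {l..r} g) ({..l} \<union> {l..r})"
      by (intro has_integral_Un integrable_integral that)
        (use lr in \<open>auto intro: negligible_subset[OF negligible_sing[of l]]\<close>)
    have 2: "(g has_integral integral {..l} g + integral {l..r} g + integral {r..} g)
        ({..l} \<union> {l..r} \<union> {r..})"
      by (intro has_integral_Un[OF 1] integrable_integral that)
        (use lr in \<open>auto intro: negligible_subset[OF negligible_sing[of r]]\<close>)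
    have "{..l} \<union> {l..r} \<union> {r..} = UNIV" using lr by auto
    with 2 show ?thesis by (auto simp: has_integral_integrable_integral)
  qed
  define m where "m = integral {l..r} (\<lambda>x. (psi x)\<^sup>2)"
  define k where "k = integral {l..r} (\<lambda>x. (psi1 x)\<^sup>2)"
  define ml where "ml = integral {..l} (\<lambda>x. (psi x)\<^sup>2)"
  define mr where "mr = integral {r..} (\<lambda>x. (psi x)\<^sup>2)"
  have mass: "ml + m + mr = 1"
  proof -
    have "integral UNIV (\<lambda>x. (psi x)\<^sup>2) = 1"
      using integral_lborel[OF int(1)] int(2) by simp
    then show ?thesis using split[of "\<lambda>x. (psi x)\<^sup>2"] by (simp add: ipsi ml_def m_def mr_def)
  qed
  have m0: "0 \<le> ml" "0 \<le> m" "0 \<le> mr"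
    unfolding ml_def m_def mr_def by (auto intro!: integral_nonneg ipsi)
  have im: "((\<lambda>x. (psi x)\<^sup>2) has_integral m) {l..r}" and ik: "((\<lambda>x. (psi1 x)\<^sup>2) has_integral k) {l..r}"
    unfolding m_def k_def by (intro integrable_integral cint continuous_intros cont)+
  have psi1U: "(\<lambda>x. (psi1 x)\<^sup>2) integrable_on UNIV"
    "integral UNIV (\<lambda>x. (psi1 x)\<^sup>2) = integral {..l} (\<lambda>x. (psi1 x)\<^sup>2) + k + integral {r..} (\<lambda>x. (psi1 x)\<^sup>2)"
    using split[of "\<lambda>x. (psi1 x)\<^sup>2"] right(2) phi1int(1) ik by (auto simp: k_def)
  have "(\<lambda>x. (psi1 x)\<^sup>2) absolutely_integrable_on UNIV"
    by (rule nonnegative_absolutely_integrable_1[OF psi1U(1)]) auto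
  then have "integrable lebesgue (\<lambda>x. (psi1 x)\<^sup>2)" by (simp add: set_integrable_def)
  then show ipsi1: "integrable lborel (\<lambda>x. (psi1 x)\<^sup>2)"
    by (rule integrable_completion[THEN iffD1, rotated])
      (auto intro!: borel_measurable_continuous_onI continuous_intros cont)

  define a where "a = integral {l..r} (\<lambda>x. (lam - V x) * (psi x)\<^sup>2)"
  have ia: "((\<lambda>x. (lam - V x) * (psi x)\<^sup>2) has_integral a) {l..r}"
    unfolding a_def by (intro integrable_integral cint continuous_intros cont)
  \<comment> \<open>Integration of (h^2 psi psi')' over the well. With the signs chosen in
    \<open>er\<close> and \<open>el\<close>, both boundary terms are nonnegative and are
    subtracted.\<close>
  have kin: "h\<^sup>2 * k = a - er - el"
  proof -
    define g where "g x = h\<^sup>2 * (psi x * psi1 x)" for x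
    have dg: "(g has_real_derivative h\<^sup>2 * (psi1 x)\<^sup>2 - (lam - V x) * (psi x)\<^sup>2) (at x)" for x
      unfolding g_def[abs_def] by (rule derivative_eq_intros d d1 refl)+
        (use h in \<open>simp add: field_simps power2_eq_square\<close>)
    have "((\<lambda>x. h\<^sup>2 * (psi1 x)\<^sup>2 - (lam - V x) * (psi x)\<^sup>2) has_integral g r - g l) {l..r}"
      by (rule has_integral_real_derivative_interior)
        (use lr dg in \<open>auto intro: continuous_at_imp_continuous_on DERIV_isCont\<close>)
    moreover have "((\<lambda>x. h\<^sup>2 * (psi1 x)\<^sup>2 - (lam - V x) * (psi x)\<^sup>2) has_integral h\<^sup>2 * k - a) {l..r}"
      by (intro has_integral_diff has_integral_mult_right ik ia)
    ultimately have "h\<^sup>2 * k - a = g r - g l" by (rule has_integral_unique[symmetric])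
    then show ?thesis by (simp add: g_def er_def el_def)
  qed
  have "a \<le> M\<^sup>2 * m"
    by (rule has_integral_le[OF ia has_integral_mult_right[OF im]]) (use V in \<open>auto intro: mult_right_mono\<close>)
  also have "\<dots> \<le> M\<^sup>2" using m0 mass M by simp
  \<comment> \<open>Thanks to these signs the kinetic energy in the well is bounded before the
    boundary terms are estimated; \<open>endpoint_bound\<close> takes this bound as input.\<close>
  finally have kin_le: "h\<^sup>2 * k \<le> M\<^sup>2" using kin right(1) left(1) by linarith
  have er: "er \<le> 3 * M ^ 4 * sqrt h"
  proof -
    have "\<bar>h\<^sup>2 * (psi r * psi1 r)\<bar> \<le> 3 * M ^ 4 * sqrt h"
      by (rule endpoint_bound[OF M h dV cV1 width V1 V(2) turn(2) d d1])
        (use m0 mass kin_le in \<open>auto simp: m_def k_def\<close>)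
    then show ?thesis by (simp add: er_def)
  qed
  have el: "el \<le> 3 * M ^ 4 * sqrt h"
  proof -
    have "\<bar>h\<^sup>2 * (phi (-l) * phi1 (-l))\<bar> \<le> 3 * M ^ 4 * sqrt h"
    proof (rule endpoint_bound[OF M h dU cU1 _ _ _ _ _ dphi dphi1])
      show "integral {- r..- l} (\<lambda>x. (phi x)\<^sup>2) \<le> 1"
        unfolding phi_def using m0 mass
          Henstock_Kurzweil_Integration.integral_reflect_real[where f="\<lambda>x. (psi x)\<^sup>2" and a=l and b=r]
        by (simp add: m_def)
      show "h\<^sup>2 * integral {- r..- l} (\<lambda>x. (phi1 x)\<^sup>2) \<le> M\<^sup>2"
        unfolding phi1_def using kin_le
          Henstock_Kurzweil_Integration.integral_reflect_real[where f="\<lambda>x. (psi1 x)\<^sup>2" and a=l and b=r]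
        by (simp add: k_def)
    qed (use width V1 V turn in \<open>auto simp: U_def U1_def\<close>)
    then show ?thesis using phiend by linarith
  qed
  define P where "P x = h\<^sup>2 * (psi1 x)\<^sup>2 + (lam - V x) * (psi x)\<^sup>2" for x
  define W where "W x = f x * P x - h\<^sup>2 * f1 x * (psi x * psi1 x)" for x
  \<comment> \<open>The derivative of \<open>W\<close> is known only in the open well. At the end
    points \<open>W1\<close> gets the ideal integrand, so the pointwise comparison below is trivial
    there.\<close>
  define W1 where "W1 x = (if x \<in> {l<..<r} then (2 * (lam - V x) * f1 x - V1 x * f x) * (psi x)\<^sup>2
    - h\<^sup>2 * f2 x * (psi x * psi1 x) else ((lam - V x) - c) * (psi x)\<^sup>2)" for x
  have iW: "(W1 has_integral W r - W l) {l..r}"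
  proof (rule has_integral_real_derivative_interior)
    show "continuous_on {l..r} W"
      unfolding W_def[abs_def] P_def by (intro continuous_intros cont f)
    fix x assume x: "x \<in> {l<..<r}"
    have "(W has_real_derivative (2 * (lam - V x) * f1 x - V1 x * f x) * (psi x)\<^sup>2
        - h\<^sup>2 * f2 x * (psi x * psi1 x)) (at x)"
      unfolding W_def[abs_def] P_def
      by (rule derivative_eq_intros d d1 dV f(3)[OF x] f(4)[OF x] refl)+
        (use h in \<open>simp add: field_simps power2_eq_square\<close>)
    then show "(W has_real_derivative W1 x) (at x)" using x by (simp add: W1_def)
  qed (use lr in auto)
  have "\<bar>W r - W l - (a - c * m)\<bar> \<le> K * sqrt h * m + K * sqrt h / 2 * (m + h\<^sup>2 * k)"
  proof -
    have i1: "((\<lambda>x. W1 x - ((lam - V x) * (psi x)\<^sup>2 - c * (psi x)\<^sup>2)) has_integral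
        (W r - W l - (a - c * m))) {l..r}"
      by (intro has_integral_diff iW ia has_integral_mult_right im)
    have i2: "((\<lambda>x. K * sqrt h * (psi x)\<^sup>2 + K * sqrt h / 2 * ((psi x)\<^sup>2 + h\<^sup>2 * (psi1 x)\<^sup>2)) has_integral
        (K * sqrt h * m + K * sqrt h / 2 * (m + h\<^sup>2 * k))) {l..r}"
      by (intro has_integral_add has_integral_mult_right im ik)
    have "norm (W1 x - ((lam - V x) * (psi x)\<^sup>2 - c * (psi x)\<^sup>2))
        \<le> K * sqrt h * (psi x)\<^sup>2 + K * sqrt h / 2 * ((psi x)\<^sup>2 + h\<^sup>2 * (psi1 x)\<^sup>2)"
      if "x \<in> {l..r}" for x
    proof (cases "x \<in> {l<..<r}")
      case True
      define R where "R = 2 * (lam - V x) * f1 x - V1 x * f x - ((lam - V x) - c)"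
      have eq: "W1 x - ((lam - V x) * (psi x)\<^sup>2 - c * (psi x)\<^sup>2)
          = R * (psi x)\<^sup>2 - f2 x * (h\<^sup>2 * (psi x * psi1 x))"
        using True by (simp add: W1_def R_def algebra_simps)
      have 1: "\<bar>R * (psi x)\<^sup>2\<bar> \<le> K * sqrt h * (psi x)\<^sup>2"
        using fODE[OF True] by (simp add: abs_mult R_def mult_right_mono)
      have am: "\<bar>h * (psi x * psi1 x)\<bar> \<le> ((psi x)\<^sup>2 + h\<^sup>2 * (psi1 x)\<^sup>2) / 2"
      proof -
        have "0 \<le> (psi x - h * psi1 x)\<^sup>2" "0 \<le> (psi x + h * psi1 x)\<^sup>2" by auto
        then show ?thesis by (simp add: power2_eq_square algebra_simps abs_le_iff)
      qed
      \<comment> \<open>One factor h is spent on the arithmetic-geometric mean \<open>am\<close>;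
        the other turns K / sqrt h into K sqrt h.\<close>
      have "\<bar>f2 x * (h\<^sup>2 * (psi x * psi1 x))\<bar> = \<bar>f2 x\<bar> * h * \<bar>h * (psi x * psi1 x)\<bar>"
        using h by (simp add: abs_mult power2_eq_square)
      also have "\<dots> \<le> (K / sqrt h) * h * (((psi x)\<^sup>2 + h\<^sup>2 * (psi1 x)\<^sup>2) / 2)"
        by (intro mult_mono f2[OF True] am mult_nonneg_nonneg) (use h K in auto)
      also have "(K / sqrt h) * h = K * sqrt h"
        using h by (simp add: field_simps real_div_sqrt)
      finally have 2: "\<bar>f2 x * (h\<^sup>2 * (psi x * psi1 x))\<bar> \<le> K * sqrt h / 2 * ((psi x)\<^sup>2 + h\<^sup>2 * (psi1 x)\<^sup>2)"
        by simp
      show ?thesis unfolding eq real_norm_def using 1 2 by linarith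
    next
      case False
      have "0 \<le> K * sqrt h * (psi x)\<^sup>2 + K * sqrt h / 2 * ((psi x)\<^sup>2 + h\<^sup>2 * (psi1 x)\<^sup>2)"
        using K h by (intro add_nonneg_nonneg mult_nonneg_nonneg) auto
      moreover have "W1 x = (lam - V x - c) * (psi x)\<^sup>2"
        using False by (simp only: W1_def if_False)
      then have "W1 x - ((lam - V x) * (psi x)\<^sup>2 - c * (psi x)\<^sup>2) = 0"
        by (simp add: left_diff_distrib)
      ultimately show ?thesis by simp
    qed
    from integral_norm_bound_integral[OF has_integral_integrable[OF i1] has_integral_integrable[OF i2] this]
    show ?thesis using integral_unique[OF i1] integral_unique[OF i2] by simp
  qed
  also have "\<dots> \<le> K * sqrt h * 1 + K * sqrt h / 2 * (1 + M\<^sup>2)"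
    using m0 mass kin_le K h by (intro add_mono mult_left_mono) auto
  also have "\<dots> \<le> K * (1 + M\<^sup>2) * sqrt h"
  proof -
    have "K * sqrt h * 1 \<le> K * sqrt h * ((1 + M\<^sup>2) / 2)"
      by (rule mult_left_mono) (use M K h one_le_power[OF M, of 2] in auto)
    then show ?thesis by (simp add: algebra_simps)
  qed
  finally have mid: "\<bar>W r - W l - (a - c * m)\<bar> \<le> K * (1 + M\<^sup>2) * sqrt h" .
  define pr where "pr = h\<^sup>2 * (psi1 r)\<^sup>2 / V1 r"
  define pl where "pl = h\<^sup>2 * (psi1 l)\<^sup>2 / - V1 l"
  \<comment> \<open>The potential part of \<open>P\<close> vanishes at the turning points, and
    \<open>f\<close> equals c / V1 there, so \<open>f * P\<close> reduces to c times the quotients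
    that \<open>half_line_balance\<close> compares with the outer masses.\<close>
  have W: "W r = c * pr + f1 r * er" "W l = - (c * pl) - f1 l * el"
    using fend turn by (auto simp: W_def P_def pr_def pl_def er_def el_def)
  have R1: "\<bar>c * (pr - mr)\<bar> \<le> K * (3 * M ^ 3 * er)" and L1: "\<bar>c * (pl - ml)\<bar> \<le> K * (3 * M ^ 3 * el)"
    unfolding abs_mult using right(4) left(4) K
    by (auto intro!: mult_mono simp: pr_def pl_def mr_def ml_def)
  have R2: "\<bar>f1 r * er\<bar> \<le> K * er" and L2: "\<bar>f1 l * el\<bar> \<le> K * el"
    using fend right(1) left(1) by (auto simp: abs_mult intro: mult_right_mono)
  \<comment> \<open>The outer masses hidden in \<open>pr\<close> and \<open>pl\<close> complete c m
    to c times the total mass, which is 1.\<close>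
  have "W r - W l - (a - c * m) = c * (pr - mr) + c * (pl - ml) + f1 r * er + f1 l * el + c * (ml + m + mr) - a"
    unfolding W by (simp add: algebra_simps)
  then have "\<bar>a - c\<bar> \<le> K * (1 + M\<^sup>2) * sqrt h + (K * (3 * M ^ 3 * er) + K * (3 * M ^ 3 * el)) + (K * er + K * el)"
    unfolding mass using mid R1 L1 R2 L2 by linarith
  then have ac: "\<bar>a - c\<bar> \<le> K * (1 + M\<^sup>2) * sqrt h + (K + 3 * K * M ^ 3) * (er + el)"
    by (simp add: algebra_simps)
  have tot: "h\<^sup>2 * (LBINT x. (psi1 x)\<^sup>2) = a - er - el
     + h\<^sup>2 * integral {..l} (\<lambda>x. (psi1 x)\<^sup>2) + h\<^sup>2 * integral {r..} (\<lambda>x. (psi1 x)\<^sup>2)"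
    unfolding integral_lborel[OF ipsi1, symmetric] psi1U(2) distrib_left kin by simp
  \<comment> \<open>The kinetic energies of the half lines lie between 0 and \<open>el\<close>,
    respectively \<open>er\<close>, so the total differs from \<open>a\<close> by at most
    \<open>er + el\<close>.\<close>
  have "0 \<le> h\<^sup>2 * integral {..l} (\<lambda>x. (psi1 x)\<^sup>2)" "0 \<le> h\<^sup>2 * integral {r..} (\<lambda>x. (psi1 x)\<^sup>2)"
    using right(2) phi1int(1) by (auto intro!: mult_nonneg_nonneg integral_nonneg)
  then have "\<bar>h\<^sup>2 * (LBINT x. (psi1 x)\<^sup>2) - c\<bar>
      \<le> K * (1 + M\<^sup>2) * sqrt h + (K + 3 * K * M ^ 3 + 1) * (er + el)"
    unfolding tot using ac right(3) left(3) by (simp add: algebra_simps)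
  also have "\<dots> \<le> K * (1 + M\<^sup>2) * sqrt h + (K + 3 * K * M ^ 3 + 1) * (6 * M ^ 4 * sqrt h)"
    by (intro add_left_mono mult_left_mono) (use er el K M in auto)
  finally show "\<bar>h\<^sup>2 * (LBINT x. (psi1 x)\<^sup>2) - c\<bar>
      \<le> (K * (1 + M\<^sup>2) + (K + 3 * K * M ^ 3 + 1) * (6 * M ^ 4)) * sqrt h"
    by (simp add: algebra_simps)
qed

section \<open>The multiplier\<close>

lemma abs_diff_le_real_derivative:
  fixes F f :: "real \<Rightarrow> real"
  assumes "\<And>z. z \<in> S \<Longrightarrow> (F has_real_derivative f z) (at z)" "\<And>z. z \<in> S \<Longrightarrow> \<bar>f z\<bar> \<le> C"
    and "convex S" "x \<in> S" "y \<in> S"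
  shows "\<bar>F x - F y\<bar> \<le> C * \<bar>x - y\<bar>"
  using field_differentiable_bound[of S F f C x y] assms
  by (simp add: has_field_derivative_at_within)

text \<open>Gives continuity up to the turning points for expressions that divide by
  \<open>a\<close> and whose formula says nothing about the limit there: a continuous majorant that
  vanishes at both ends is enough.\<close>

lemma continuous_on_vanishing_ends:
  fixes F \<phi> :: "real \<Rightarrow> real"
  assumes \<phi>: "continuous_on {l..r} \<phi>" "\<phi> l = 0" "\<phi> r = 0"
    and le: "\<And>x. x \<in> {l..r} \<Longrightarrow> \<bar>F x\<bar> \<le> \<phi> x"
    and int: "\<And>x. x \<in> {l<..<r} \<Longrightarrow> isCont F x"
  shows "continuous_on {l..r} F"
  unfolding continuous_on
proof
  fix x assume x: "x \<in> {l..r}"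
  show "(F \<longlongrightarrow> F x) (at x within {l..r})"
  proof (cases "x \<in> {l<..<r}")
    case True
    then show ?thesis using int[OF True] isCont_def tendsto_within_subset by blast
  next
    case False
    then have z: "\<phi> x = 0" using x \<phi> by (cases "x = l") auto
    then have "F x = 0" using le[OF x] by simp
    moreover have "(F \<longlongrightarrow> 0) (at x within {l..r})"
    proof (rule Lim_null_comparison)
      show "\<forall>\<^sub>F y in at x within {l..r}. norm (F y) \<le> \<phi> y"
        using le by (auto simp: eventually_at_filter)
      show "(\<phi> \<longlongrightarrow> 0) (at x within {l..r})"
        using \<phi>(1) x z by (metis continuous_on)
    qed
    ultimately show ?thesis by simp
  qed
qed

text \<open>\<open>well\<close> combines the simple zeros of lam - V at the ends with its positivity
  in between: it makes \<open>a\<close> comparable from below with the distance to the nearer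
  turning point. Since \<open>M\<close> is the only quantitative parameter, bounds proved here are
  uniform over all wells sharing it.\<close>

locale potential_well =
  fixes V V1 V2 :: "real \<Rightarrow> real" and lam l r M :: real
  assumes M: "1 \<le> M"
    and dV: "(V has_real_derivative V1 x) (at x)"
    and dV1: "(V1 has_real_derivative V2 x) (at x)"
    and width: "1 \<le> M * (r - l)" "r - l \<le> M"
    and V1_le: "x \<in> {l..r} \<Longrightarrow> \<bar>V1 x\<bar> \<le> M"
    and V2_le: "x \<in> {l..r} \<Longrightarrow> \<bar>V2 x\<bar> \<le> M"
    and ends: "V l = lam" "V r = lam" "1 \<le> M * V1 r" "1 \<le> M * (- V1 l)"
    and well: "x \<in> {l..r} \<Longrightarrow> min (x - l) (r - x) \<le> M * (lam - V x)"
begin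

text \<open>\<open>k\<close> solves \<open>2 a k' + V1 k = 2 a\<^sup>2 w\<close> and vanishes to second order at both turning points;
  \<open>c * f0 + k / a\<close> is the exact multiplier. The derivatives of \<open>H\<close>, \<open>w\<close> and \<open>k\<close> in the open
  well are \<open>H1\<close>, \<open>w1\<close>, \<open>k1\<close> and \<open>k2\<close>; at the turning points \<open>w0\<close> and \<open>k1\<close> rely on
  \<open>0 / 0 = 0\<close>.\<close>

definition "a x = lam - V x"
definition "p x = sqrt (a x)"
text \<open>The slope of the linear interpolant \<open>f0\<close> of 1 / V1 between the two turning
  points.\<close>

definition "s = (1 / V1 r - 1 / V1 l) / (r - l)"
definition "f0 x = 1 / V1 l + s * (x - l)"
definition "H x = 1 - V1 x * f0 x"
definition "H1 x = - (V2 x * f0 x + V1 x * s)"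
definition "w0 x = s + H x / (2 * a x)"
definition "c = integral {l..r} p / integral {l..r} (\<lambda>x. 1 / p x)"
text \<open>Inserting c f0 + k / a into 2 a f' - V1 f = a - c leaves 2 k' + V1 k / a = 2 a w with
  exactly this \<open>w\<close>.\<close>

definition "w x = 1 / 2 - c * w0 x"
definition "w1 x = - (c * (H1 x / (2 * a x) + H x * V1 x / (2 * (a x)\<^sup>2)))"
text \<open>Variation of constants: p solves the homogeneous equation for \<open>k\<close>, and the
  quotient k / p has derivative p w.\<close>

definition "G x = integral {l..x} (\<lambda>x. p x * w x)"
definition "k x = G x * p x"
definition "k1 x = a x * w x - V1 x * k x / (2 * a x)"
definition "k2 x = - V1 x * w x + a x * w1 x - V2 x * k x / (2 * a x)
  - V1 x * k1 x / (2 * a x) - (V1 x)\<^sup>2 * k x / (2 * (a x)\<^sup>2)"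

lemma lr: "l < r"
proof -
  have "0 < M * (r - l)" using width by linarith
  then show ?thesis using M by (simp add: zero_less_mult_iff)
qed

lemma M_mono: "i \<le> j \<Longrightarrow> M ^ i \<le> M ^ j"
  using M by (rule power_increasing[rotated])

lemma da: "(a has_real_derivative - V1 x) (at x)"
  unfolding a_def[abs_def] by (rule derivative_eq_intros dV refl)+ simp

lemma a_ends: "a l = 0" "a r = 0"
  using ends by (auto simp: a_def)

lemma a_pos: "x \<in> {l<..<r} \<Longrightarrow> 0 < a x"
proof -
  assume "x \<in> {l<..<r}"
  then have "0 < M * a x" using well[of x] by (auto simp: a_def)
  then show ?thesis using M by (simp add: zero_less_mult_iff)
qed

lemma a_nonneg: "x \<in> {l..r} \<Longrightarrow> 0 \<le> a x"
  using a_pos[of x] a_ends by (cases "x = l \<or> x = r") (auto simp: less_imp_le)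

lemma a_upper: "x \<in> {l..r} \<Longrightarrow> a x \<le> M * (x - l)" "x \<in> {l..r} \<Longrightarrow> a x \<le> M * (r - x)"
proof -
  assume x: "x \<in> {l..r}"
  have *: "\<bar>a x - a y\<bar> \<le> M * \<bar>x - y\<bar>" if "y \<in> {l..r}" for y
    by (rule abs_diff_le_real_derivative[OF da, where S="{l..r}"]) (use V1_le x that in auto)
  show "a x \<le> M * (x - l)" "a x \<le> M * (r - x)"
    using *[of l] *[of r] x a_ends by (auto simp: abs_minus_commute)
qed

lemma a_le: "x \<in> {l..r} \<Longrightarrow> a x \<le> M\<^sup>2"
proof -
  assume x: "x \<in> {l..r}"
  have "M * (x - l) \<le> M * M" by (rule mult_left_mono) (use x width M in auto)
  then show ?thesis using a_upper[OF x] by (simp add: power2_eq_square)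
qed

lemma cont_a: "continuous_on S a"
  by (auto intro!: continuous_at_imp_continuous_on DERIV_isCont da)

lemma p_ends: "p l = 0" "p r = 0"
  by (auto simp: p_def a_ends)

lemma p_pos: "x \<in> {l<..<r} \<Longrightarrow> 0 < p x"
  by (simp add: p_def a_pos)

lemma p_nonneg: "x \<in> {l..r} \<Longrightarrow> 0 \<le> p x"
  by (simp add: p_def a_nonneg)

lemma p_sq: "x \<in> {l..r} \<Longrightarrow> p x * p x = a x"
  by (simp add: p_def a_nonneg)

lemma cont_p: "continuous_on S p"
  unfolding p_def[abs_def] by (intro continuous_intros cont_a)

lemma dp: "x \<in> {l<..<r} \<Longrightarrow> (p has_real_derivative - V1 x / (2 * p x)) (at x)"
  unfolding p_def[abs_def]
  using DERIV_chain2[OF DERIV_real_sqrt[OF a_pos] da, of x] by (simp add: field_simps)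

lemma inv_ends: "0 < 1 / V1 r" "1 / V1 r \<le> M" "1 / V1 l < 0" "- M \<le> 1 / V1 l"
proof -
  have "0 < M * V1 r" "0 < M * (- V1 l)" using ends by linarith+
  then have *: "0 < V1 r" "V1 l < 0" using M by (auto simp: zero_less_mult_iff mult_less_0_iff)
  then show "0 < 1 / V1 r" "1 / V1 l < 0" by auto
  show "1 / V1 r \<le> M" "- M \<le> 1 / V1 l" using ends * by (auto simp: field_simps)
qed

lemma s_bounds: "0 \<le> s" "s \<le> 2 * M\<^sup>2"
proof -
  show "0 \<le> s" unfolding s_def using inv_ends lr by (intro divide_nonneg_nonneg) linarith+
  have "1 / (r - l) \<le> M" using width lr by (simp add: field_simps)
  then have "(1 / V1 r - 1 / V1 l) * (1 / (r - l)) \<le> (2 * M) * M"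
    by (intro mult_mono) (use inv_ends lr M in auto)
  then show "s \<le> 2 * M\<^sup>2" by (simp add: s_def power2_eq_square)
qed

lemma f0_ends: "f0 l = 1 / V1 l" "f0 r = 1 / V1 r"
  using lr by (auto simp: f0_def s_def)

lemma f0_le: "x \<in> {l..r} \<Longrightarrow> \<bar>f0 x\<bar> \<le> M"
proof -
  assume x: "x \<in> {l..r}"
  have "s * (x - l) \<le> s * (r - l)" "0 \<le> s * (x - l)"
    using x s_bounds by (auto intro: mult_left_mono)
  then have "f0 l \<le> f0 x" "f0 x \<le> f0 r" by (auto simp: f0_def)
  then show ?thesis using inv_ends f0_ends by linarith
qed

lemma df0: "(f0 has_real_derivative s) (at x)"
  unfolding f0_def[abs_def] by (rule derivative_eq_intros refl)+ simp

lemma dH: "(H has_real_derivative H1 x) (at x)"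
  unfolding H_def[abs_def] H1_def by (rule derivative_eq_intros dV1 df0 refl)+ simp

lemma H1_le: "x \<in> {l..r} \<Longrightarrow> \<bar>H1 x\<bar> \<le> 3 * M ^ 3"
proof -
  assume x: "x \<in> {l..r}"
  have "\<bar>V2 x * f0 x\<bar> \<le> M * M" "\<bar>V1 x * s\<bar> \<le> M * (2 * M\<^sup>2)"
    unfolding abs_mult by (intro mult_mono; use V1_le V2_le f0_le s_bounds x M in auto)+
  moreover have "M * M \<le> M ^ 3" "M * (2 * M\<^sup>2) = 2 * M ^ 3"
    using M_mono[of 2 3] by (auto simp: power2_eq_square power3_eq_cube)
  ultimately show ?thesis unfolding H1_def by linarith
qed

text \<open>\<open>H\<close> vanishes at both ends because \<open>f0\<close> equals 1 / V1 there.
  The bound on its slope makes it at most a multiple of the distance to the nearer end, which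
  \<open>well\<close> converts into \<open>a\<close>; this is what keeps \<open>w0\<close>
  bounded.\<close>

lemma H_le: "x \<in> {l..r} \<Longrightarrow> \<bar>H x\<bar> \<le> 3 * M ^ 4 * a x"
proof -
  assume x: "x \<in> {l..r}"
  have *: "\<bar>H x - H y\<bar> \<le> 3 * M ^ 3 * \<bar>x - y\<bar>" if "y \<in> {l..r}" for y
    by (rule abs_diff_le_real_derivative[OF dH, where S="{l..r}"]) (use H1_le x that in auto)
  have "H l = 0" "H r = 0" using inv_ends by (auto simp: H_def f0_ends)
  then have "\<bar>H x\<bar> \<le> 3 * M ^ 3 * min (x - l) (r - x)"
    using *[of l] *[of r] x by (auto simp: abs_minus_commute min_def)
  also have "\<dots> \<le> 3 * M ^ 3 * (M * a x)"
    by (rule mult_left_mono) (use well[OF x] M in \<open>auto simp: a_def\<close>)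
  finally show ?thesis by (simp add: eval_nat_numeral)
qed

lemma w0_le: "x \<in> {l..r} \<Longrightarrow> \<bar>w0 x\<bar> \<le> 4 * M ^ 4"
proof -
  assume x: "x \<in> {l..r}"
  have "\<bar>H x / (2 * a x)\<bar> \<le> 3 / 2 * M ^ 4"
  proof (cases "a x = 0")
    case False
    then have "0 < a x" using a_nonneg[OF x] by simp
    then show ?thesis using H_le[OF x] by (simp add: abs_mult field_simps)
  qed simp
  moreover have "M\<^sup>2 \<le> M ^ 4" by (rule M_mono) simp
  moreover have "0 \<le> M ^ 4" using M by simp
  ultimately show ?thesis using s_bounds unfolding w0_def by linarith
qed

lemma dw0: "x \<in> {l<..<r} \<Longrightarrow>
  (w0 has_real_derivative H1 x / (2 * a x) + H x * V1 x / (2 * (a x)\<^sup>2)) (at x)"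
  unfolding w0_def[abs_def] using a_pos[of x]
  by (auto intro!: derivative_eq_intros dH da simp: field_simps power2_eq_square)

text \<open>Only boundedness of \<open>w0\<close> is known at the turning points; the factor
  \<open>p\<close> supplies the vanishing majorant.\<close>

lemma cont_pw0: "continuous_on {l..r} (\<lambda>x. p x * w0 x)"
proof (rule continuous_on_vanishing_ends)
  show "continuous_on {l..r} (\<lambda>x. 4 * M ^ 4 * p x)" by (intro continuous_intros cont_p)
  fix x
  show "\<bar>p x * w0 x\<bar> \<le> 4 * M ^ 4 * p x" if "x \<in> {l..r}"
    using mult_left_mono[OF w0_le[OF that] p_nonneg[OF that]] p_nonneg[OF that]
    by (simp add: abs_mult mult.commute)
  show "isCont (\<lambda>x. p x * w0 x) x" if "x \<in> {l<..<r}"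
    by (intro continuous_mult DERIV_isCont[OF dp[OF that]] DERIV_isCont[OF dw0[OF that]])
qed (auto simp: p_ends)

lemma d_integral:
  assumes "continuous_on {l..r} g" "x \<in> {l<..<r}"
  shows "((\<lambda>x. integral {l..x} g) has_real_derivative g x) (at x)"
  using integral_has_real_derivative[OF assms(1), of x] assms(2)
  by (simp add: at_within_Icc_at)

text \<open>\<open>p * w0 - 1 / (2 * p)\<close> is the derivative of \<open>p * f0\<close>, which vanishes at both
  turning points.\<close>

lemma inverse_p_integral: "((\<lambda>x. 1 / p x) has_integral 2 * integral {l..r} (\<lambda>x. p x * w0 x)) {l..r}"
proof -
  define F where "F x = integral {l..x} (\<lambda>x. p x * w0 x) - p x * f0 x" for x
  have "((\<lambda>x. 1 / (2 * p x)) has_integral F r - F l) {l..r}"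
  proof (rule has_integral_real_derivative_interior)
    show "continuous_on {l..r} F"
      unfolding F_def[abs_def]
      by (intro continuous_intros indefinite_integral_continuous_1 integrable_continuous_real
          cont_pw0 cont_p continuous_at_imp_continuous_on ballI DERIV_isCont[OF df0])
    fix x assume x: "x \<in> {l<..<r}"
    have "(F has_real_derivative p x * w0 x - (- V1 x / (2 * p x) * f0 x + s * p x)) (at x)"
      unfolding F_def[abs_def]
      by (rule DERIV_diff DERIV_mult d_integral cont_pw0 x dp df0)+
    moreover have "p x * w0 x - (- V1 x / (2 * p x) * f0 x + s * p x) = 1 / (2 * p x)"
      using p_pos[OF x] p_sq[of x] x unfolding w0_def H_def
      by (simp add: field_simps flip: p_sq)
    ultimately show "(F has_real_derivative 1 / (2 * p x)) (at x)" by simp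
  qed (use lr in auto)
  moreover have "F r - F l = integral {l..r} (\<lambda>x. p x * w0 x)" by (simp add: F_def p_ends)
  ultimately show ?thesis using has_integral_mult_right[of "\<lambda>x. 1 / (2 * p x)" _ "{l..r}" 2] by simp
qed

lemma inverse_p_integrable: "(\<lambda>x. 1 / p x) integrable_on {l..r}"
  using inverse_p_integral by blast

lemma c_nonneg: "0 \<le> c"
  unfolding c_def
  by (intro divide_nonneg_nonneg integral_nonneg inverse_p_integrable integrable_continuous_real cont_p)
    (auto simp: p_nonneg)

lemma p_integral_le: "integral {l..r} p \<le> M\<^sup>2 * integral {l..r} (\<lambda>x. 1 / p x)"
proof -
  have "integral {l..r} p \<le> integral {l..r} (\<lambda>x. M\<^sup>2 * (1 / p x))"
  proof (rule integral_le)
    fix x assume x: "x \<in> {l..r}"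
    show "p x \<le> M\<^sup>2 * (1 / p x)"
    proof (cases "p x = 0")
      case False
      then show ?thesis using a_le[OF x] p_nonneg[OF x] p_sq[OF x] by (simp add: field_simps)
    qed simp
  qed (intro integrable_continuous_real cont_p integrable_on_mult_right inverse_p_integrable)+
  then show ?thesis by (simp only: integral_mult_right)
qed

lemma inverse_p_integral_nonneg: "0 \<le> integral {l..r} (\<lambda>x. 1 / p x)"
  by (rule integral_nonneg[OF inverse_p_integrable]) (auto simp: p_nonneg)

lemma p_integral_nonneg: "0 \<le> integral {l..r} p"
  by (rule integral_nonneg) (auto simp: p_nonneg intro: integrable_continuous_real cont_p)

lemma c_le: "c \<le> M\<^sup>2"
proof (cases "integral {l..r} (\<lambda>x. 1 / p x) = 0")
  case False
  then show ?thesis using p_integral_le inverse_p_integral_nonneg by (simp add: c_def field_simps)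
qed (simp add: c_def)

text \<open>The degenerate case of a zero denominator is covered too: \<open>p_integral_le\<close>
  then forces the integral of \<open>p\<close> to be 0 as well.\<close>

lemma c_eq: "c * integral {l..r} (\<lambda>x. 1 / p x) = integral {l..r} p"
  using p_integral_le p_integral_nonneg by (auto simp: c_def)

lemma w_le: "x \<in> {l..r} \<Longrightarrow> \<bar>w x\<bar> \<le> 5 * M ^ 6"
proof -
  assume x: "x \<in> {l..r}"
  have "\<bar>c * w0 x\<bar> \<le> M\<^sup>2 * (4 * M ^ 4)"
    unfolding abs_mult by (rule mult_mono) (use c_le c_nonneg w0_le[OF x] in auto)
  also have "M\<^sup>2 * (4 * M ^ 4) = 4 * M ^ 6" by (simp add: eval_nat_numeral)
  finally show ?thesis using one_le_power[OF M, of 6] unfolding w_def by linarith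
qed

lemma dw: "x \<in> {l<..<r} \<Longrightarrow> (w has_real_derivative w1 x) (at x)"
  unfolding w_def[abs_def] w1_def by (rule derivative_eq_intros dw0 refl | assumption)+ simp

lemma pw_eq: "p x * w x = 1 / 2 * p x - c * (p x * w0 x)"
  by (simp add: w_def algebra_simps)

lemma cont_pw: "continuous_on {l..r} (\<lambda>x. p x * w x)"
  unfolding pw_eq by (intro continuous_intros cont_p cont_pw0)

text \<open>The solvability condition that selects \<open>c\<close>: by
  \<open>inverse_p_integral\<close>, the integral of p w is half of int p - c int 1/p.\<close>

lemma G_right: "G r = 0"
proof -
  have "G r = 1 / 2 * integral {l..r} p - c * integral {l..r} (\<lambda>x. p x * w0 x)"
    unfolding G_def pw_eq
    by (simp add: Henstock_Kurzweil_Integration.integral_diff integrable_continuous_real cont_p cont_pw0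
      continuous_on_mult_left)
  also have "integral {l..r} (\<lambda>x. p x * w0 x) = 1 / 2 * integral {l..r} (\<lambda>x. 1 / p x)"
    using integral_unique[OF inverse_p_integral] by simp
  finally show ?thesis using c_eq by simp
qed

lemma dG: "x \<in> {l<..<r} \<Longrightarrow> (G has_real_derivative p x * w x) (at x)"
  unfolding G_def[abs_def] by (rule d_integral[OF cont_pw])

text \<open>Since \<open>G\<close> vanishes at both ends, it can be integrated from the nearer one.
  At distance t from it, p <= sqrt (M t), \<open>w\<close> is bounded and the length is t, which
  gives order t^(3/2), and t <= M a turns this into order a p. This order is what makes
  \<open>k\<close> vanish like a^2.\<close>

lemma G_le: "x \<in> {l..r} \<Longrightarrow> \<bar>G x\<bar> \<le> 5 * M ^ 8 * a x * p x"
proof -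
  assume x: "x \<in> {l..r}"
  define t where "t = min (x - l) (r - x)"
  have t: "0 \<le> t" "t \<le> M * a x" using x well[OF x] by (auto simp: t_def a_def)
  have int: "(\<lambda>x. p x * w x) integrable_on {y..z}" if "l \<le> y" "z \<le> r" for y z
    using that by (intro integrable_continuous_real continuous_on_subset[OF cont_pw]) auto
  have bound: "\<bar>integral {y..z} (\<lambda>x. p x * w x)\<bar> \<le> 5 * M ^ 6 * sqrt (M * d) * (z - y)"
    if "l \<le> y" "y \<le> z" "z \<le> r" "\<And>v. v \<in> {y..z} \<Longrightarrow> a v \<le> M * d" for y z d
  proof -
    have "norm (integral {y..z} (\<lambda>x. p x * w x)) \<le> integral {y..z} (\<lambda>_. sqrt (M * d) * (5 * M ^ 6))"
    proof (rule integral_norm_bound_integral[OF int])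
      fix v assume v: "v \<in> {y..z}"
      then show "norm (p v * w v) \<le> sqrt (M * d) * (5 * M ^ 6)"
        unfolding real_norm_def abs_mult
        using that w_le[of v] p_nonneg[of v] that(4)[OF v] a_nonneg[of v]
          order.trans[OF a_nonneg[of v] that(4)[OF v]]
        by (intro mult_mono) (auto simp: p_def)
    qed (use that in auto)
    then show ?thesis using that by (simp add: mult_ac)
  qed
  have "\<bar>G x\<bar> \<le> 5 * M ^ 6 * sqrt (M * t) * t"
  proof (cases "x - l \<le> r - x")
    case True
    have "a v \<le> M * (x - l)" if "v \<in> {l..x}" for v
    proof -
      have "M * (v - l) \<le> M * (x - l)" by (rule mult_left_mono) (use that M in auto)
      then show ?thesis using a_upper(1)[of v] that x by auto
    qed
    from bound[OF _ _ _ this] show ?thesis using x True by (simp add: G_def t_def)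
  next
    case False
    have "a v \<le> M * (r - x)" if "v \<in> {x..r}" for v
    proof -
      have "M * (r - v) \<le> M * (r - x)" by (rule mult_left_mono) (use that M in auto)
      then show ?thesis using a_upper(2)[of v] that x by auto
    qed
    from bound[OF _ _ _ this] have "\<bar>integral {x..r} (\<lambda>x. p x * w x)\<bar> \<le> 5 * M ^ 6 * sqrt (M * t) * t"
      using x False by (simp add: t_def)
    \<comment> \<open>In the right half the integral is taken from the right end, which is possible
      because G r = 0.\<close>
    moreover have "G x + integral {x..r} (\<lambda>x. p x * w x) = 0"
      using Henstock_Kurzweil_Integration.integral_combine[of l x r "\<lambda>x. p x * w x"] int[of l r] G_right x
      by (simp add: G_def)
    ultimately show ?thesis by linarith
  qed
  also have "\<dots> \<le> 5 * M ^ 6 * (M * p x) * (M * a x)"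
  proof -
    have "M * t \<le> M\<^sup>2 * a x" using mult_left_mono[OF t(2), of M] M by (simp add: power2_eq_square mult.assoc)
    then have "sqrt (M * t) \<le> M * p x"
      using real_sqrt_le_mono M by (fastforce simp: p_def real_sqrt_mult)
    then show ?thesis using t M by (intro mult_mono mult_left_mono) (auto simp: p_nonneg[OF x])
  qed
  finally show ?thesis by (simp add: eval_nat_numeral mult_ac)
qed

lemma k_le: "x \<in> {l..r} \<Longrightarrow> \<bar>k x\<bar> \<le> 5 * M ^ 8 * (a x)\<^sup>2"
proof -
  assume x: "x \<in> {l..r}"
  have "\<bar>k x\<bar> \<le> 5 * M ^ 8 * a x * p x * p x"
    unfolding k_def abs_mult using G_le[OF x] p_nonneg[OF x] by (simp add: mult_right_mono)
  then show ?thesis using p_sq[OF x] by (simp add: power2_eq_square mult.assoc)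
qed

lemma k_div_a_le: "x \<in> {l..r} \<Longrightarrow> \<bar>k x / a x\<bar> \<le> 5 * M ^ 8 * a x"
  using k_le[of x] a_nonneg[of x] M by (cases "a x = 0") (auto simp: field_simps power2_eq_square)

lemma dk: "x \<in> {l<..<r} \<Longrightarrow> (k has_real_derivative k1 x) (at x)"
proof -
  assume x: "x \<in> {l<..<r}"
  have "(k has_real_derivative p x * w x * p x + (- V1 x / (2 * p x)) * G x) (at x)"
    unfolding k_def[abs_def] by (rule DERIV_mult dG dp x)+
  moreover have "p x * w x * p x + (- V1 x / (2 * p x)) * G x = k1 x"
    using p_pos[OF x] x unfolding k1_def k_def by (simp add: field_simps flip: p_sq)
  ultimately show ?thesis by simp
qed

lemma k1_le: "x \<in> {l..r} \<Longrightarrow> \<bar>k1 x\<bar> \<le> 8 * M ^ 9 * a x"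
proof -
  assume x: "x \<in> {l..r}"
  have "\<bar>a x * w x\<bar> \<le> a x * (5 * M ^ 6)"
    unfolding abs_mult using w_le[OF x] a_nonneg[OF x] by (simp add: mult_left_mono)
  also have "\<dots> \<le> a x * (5 * M ^ 9)"
    using M_mono[of 6 9] a_nonneg[OF x] by (simp add: mult_left_mono)
  finally have 1: "\<bar>a x * w x\<bar> \<le> a x * (5 * M ^ 9)" .
  have "\<bar>V1 x * k x / (2 * a x)\<bar> = \<bar>V1 x\<bar> * \<bar>k x / a x\<bar> / 2" by (simp add: abs_mult)
  also have "\<dots> \<le> M * (5 * M ^ 8 * a x) / 2"
    using V1_le[OF x] k_div_a_le[OF x] M by (intro divide_right_mono mult_mono) auto
  finally have 2: "\<bar>V1 x * k x / (2 * a x)\<bar> \<le> a x * (5 / 2 * M ^ 9)"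
    by (simp add: eval_nat_numeral mult_ac)
  have "0 \<le> a x * M ^ 9" using a_nonneg[OF x] M by simp
  moreover have "\<bar>k1 x\<bar> \<le> \<bar>a x * w x\<bar> + \<bar>V1 x * k x / (2 * a x)\<bar>"
    unfolding k1_def by (rule abs_triangle_ineq4)
  ultimately show ?thesis using 1 2 by (simp only: mult.left_commute[of "a x"] mult.commute[of "a x"])
qed

lemma dk1: "x \<in> {l<..<r} \<Longrightarrow> (k1 has_real_derivative k2 x) (at x)"
  unfolding k1_def[abs_def] k2_def using a_pos[of x]
  by (auto intro!: derivative_eq_intros da dw dV1 dk simp: field_simps power2_eq_square k1_def)

text \<open>The bound H = O(a) lowers the singularity of \<open>w1\<close> from 1/a^2 to 1/a; the
  factor \<open>a\<close> with which \<open>w1\<close> enters \<open>k2\<close> absorbs the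
  rest.\<close>

lemma w1_le: "x \<in> {l<..<r} \<Longrightarrow> \<bar>a x * w1 x\<bar> \<le> 3 * M ^ 7"
proof -
  assume x: "x \<in> {l<..<r}"
  then have x': "x \<in> {l..r}" by auto
  note ap = a_pos[OF x]
  define B where "B = V1 x * (H x / a x)"
  have eq: "a x * w1 x = - c * (H1 x / 2 + B / 2)"
    using ap by (simp add: w1_def B_def field_simps power2_eq_square)
  have "\<bar>B\<bar> \<le> M * (3 * M ^ 4)"
    unfolding B_def abs_mult
    by (rule mult_mono) (use V1_le[OF x'] H_le[OF x'] ap M in \<open>auto simp: field_simps\<close>)
  moreover have "M * (3 * M ^ 4) = 3 * M ^ 5" by (simp add: eval_nat_numeral)
  moreover have "M ^ 3 \<le> M ^ 5" by (rule M_mono) simp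
  ultimately have "\<bar>H1 x / 2 + B / 2\<bar> \<le> 3 * M ^ 5"
    using H1_le[OF x'] by linarith
  then have "\<bar>a x * w1 x\<bar> \<le> M\<^sup>2 * (3 * M ^ 5)"
    unfolding eq abs_mult using c_le c_nonneg by (intro mult_mono) auto
  then show ?thesis by (simp add: eval_nat_numeral mult_ac)
qed

text \<open>The divisions by a and a^2 are compensated by k = O(a^2) and k' = O(a). The coefficient
  17 is the sum 5 + 3 + 5/2 + 4 + 5/2 over the five summands.\<close>

lemma k2_le: "x \<in> {l<..<r} \<Longrightarrow> \<bar>k2 x\<bar> \<le> 17 * M ^ 11"
proof -
  assume x: "x \<in> {l<..<r}"
  then have x': "x \<in> {l..r}" by auto
  note ap = a_pos[OF x]
  have 1: "\<bar>V1 x * w x\<bar> \<le> M * (5 * M ^ 6)"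
    unfolding abs_mult by (rule mult_mono) (use V1_le[OF x'] w_le[OF x'] M in auto)
  have "\<bar>V2 x * (k x / a x)\<bar> \<le> M * (5 * M ^ 8 * M\<^sup>2)"
    unfolding abs_mult
  proof (rule mult_mono)
    show "\<bar>k x / a x\<bar> \<le> 5 * M ^ 8 * M\<^sup>2"
      using k_div_a_le[OF x'] mult_left_mono[OF a_le[OF x'], of "5 * M ^ 8"] M by (meson order.trans zero_le_mult_iff zero_le_numeral zero_le_power le_numeral_extra(1))
  qed (use V2_le[OF x'] M in auto)
  then have 2: "\<bar>V2 x * k x / (2 * a x)\<bar> \<le> 5 / 2 * M ^ 11" by (simp add: eval_nat_numeral abs_mult)
  have "\<bar>V1 x * (k1 x / a x)\<bar> \<le> M * (8 * M ^ 9)"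
    unfolding abs_mult
    by (rule mult_mono) (use V1_le[OF x'] k1_le[OF x'] ap M in \<open>auto simp: field_simps\<close>)
  then have 3: "\<bar>V1 x * k1 x / (2 * a x)\<bar> \<le> 4 * M ^ 10" by (simp add: eval_nat_numeral abs_mult)
  have "\<bar>(V1 x)\<^sup>2 * (k x / (a x)\<^sup>2)\<bar> \<le> M\<^sup>2 * (5 * M ^ 8)"
    unfolding abs_mult
  proof (rule mult_mono)
    show "\<bar>(V1 x)\<^sup>2\<bar> \<le> M\<^sup>2" using power_mono[OF V1_le[OF x'], of 2] by simp
    show "\<bar>k x / (a x)\<^sup>2\<bar> \<le> 5 * M ^ 8" using k_le[OF x'] ap by (simp add: field_simps)
  qed (use M in auto)
  then have 4: "\<bar>(V1 x)\<^sup>2 * k x / (2 * (a x)\<^sup>2)\<bar> \<le> 5 / 2 * M ^ 10" by (simp add: eval_nat_numeral abs_mult)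
  have "M * M ^ 6 \<le> M ^ 11" "M ^ 7 \<le> M ^ 11" "M ^ 10 \<le> M ^ 11"
    using M_mono[of 7 11] M_mono[of 10 11] by (simp_all add: power_Suc[symmetric] del: power_Suc)
  moreover have "0 \<le> M ^ 11" using M by simp
  ultimately show ?thesis using 1 2 3 4 w1_le[OF x] unfolding k2_def by linarith
qed

end

section \<open>The regularised multiplier and its bounds\<close>

context potential_well
begin

lemma cont_V1: "continuous_on S V1"
  by (auto intro!: continuous_at_imp_continuous_on DERIV_isCont dV1)

lemma cont_k: "continuous_on {l..r} k"
proof (rule continuous_on_vanishing_ends)
  show "continuous_on {l..r} (\<lambda>x. 5 * M ^ 8 * (a x)\<^sup>2)" by (intro continuous_intros cont_a)
qed (use k_le DERIV_isCont[OF dk] in \<open>auto simp: a_ends\<close>)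

lemma cont_k1: "continuous_on {l..r} k1"
proof (rule continuous_on_vanishing_ends)
  show "continuous_on {l..r} (\<lambda>x. 8 * M ^ 9 * a x)" by (intro continuous_intros cont_a)
qed (use k1_le DERIV_isCont[OF dk1] in \<open>auto simp: a_ends\<close>)

text \<open>Keeps the regularised summand out of the boundary data: for every e > 0,
  \<open>f e\<close> agrees with c f0 at the ends and \<open>f1 e\<close> equals c s there.\<close>

lemma k_ends: "k l = 0" "k r = 0" "k1 l = 0" "k1 r = 0"
  using k_le[of l] k_le[of r] k1_le[of l] k1_le[of r] lr by (auto simp: a_ends)

definition "y e x = a x + e"
definition "f e x = c * f0 x + k x / y e x"
definition "f1 e x = c * s + (k1 x / y e x + k x * V1 x / (y e x)\<^sup>2)"
definition "f2 e x = k2 x / y e x + 2 * k1 x * V1 x / (y e x)\<^sup>2 + k x * V2 x / (y e x)\<^sup>2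
  + 2 * k x * (V1 x)\<^sup>2 / (y e x) ^ 3"

context
  fixes e :: real
  assumes e: "0 < e"
begin

lemma y_pos: "x \<in> {l..r} \<Longrightarrow> 0 < y e x"
  using a_nonneg[of x] e by (simp add: y_def)

lemma cont_y: "continuous_on S (y e)"
  unfolding y_def[abs_def] by (intro continuous_intros cont_a)

lemma dy: "(y e has_real_derivative - V1 x) (at x)"
  unfolding y_def[abs_def] by (rule derivative_eq_intros da refl)+ simp

lemma cont_f: "continuous_on {l..r} (f e)"
  unfolding f_def[abs_def]
  by (intro continuous_intros cont_k cont_y continuous_at_imp_continuous_on ballI DERIV_isCont[OF df0])
    (metis y_pos less_irrefl)

lemma cont_f1: "continuous_on {l..r} (f1 e)"
  unfolding f1_def[abs_def]
  by (intro continuous_intros cont_k cont_k1 cont_y cont_V1)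
    (use y_pos in \<open>auto simp: less_imp_neq[symmetric]\<close>)

lemma df: "x \<in> {l<..<r} \<Longrightarrow> (f e has_real_derivative f1 e x) (at x)"
  unfolding f_def[abs_def] f1_def using y_pos[of x]
  by (auto intro!: derivative_eq_intros df0 dk dy simp: field_simps power2_eq_square)

lemma df1: "x \<in> {l<..<r} \<Longrightarrow> (f1 e has_real_derivative f2 e x) (at x)"
  unfolding f1_def[abs_def] f2_def using y_pos[of x]
  by (auto intro!: derivative_eq_intros dk dk1 dV1 dy simp: field_simps power2_eq_square power3_eq_cube)

lemma f_ends: "f e l = c / V1 l" "f e r = c / V1 r"
  by (simp_all add: f_def k_ends f0_ends)

lemma f1_ends: "\<bar>f1 e l\<bar> \<le> 48 * M ^ 11" "\<bar>f1 e r\<bar> \<le> 48 * M ^ 11"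
proof -
  have "\<bar>c * s\<bar> \<le> M\<^sup>2 * (2 * M\<^sup>2)"
    unfolding abs_mult by (rule mult_mono) (use c_le c_nonneg s_bounds in auto)
  also have "\<dots> = 2 * M ^ 4" by (simp add: eval_nat_numeral)
  also have "\<dots> \<le> 2 * M ^ 11" using M_mono[of 4 11] by simp
  also have "\<dots> \<le> 48 * M ^ 11" using M by simp
  finally show "\<bar>f1 e l\<bar> \<le> 48 * M ^ 11" "\<bar>f1 e r\<bar> \<le> 48 * M ^ 11"
    by (simp_all add: f1_def k_ends)
qed

lemma a_div_y: "x \<in> {l..r} \<Longrightarrow> 0 \<le> a x / y e x" "x \<in> {l..r} \<Longrightarrow> a x / y e x \<le> 1"
  using a_nonneg[of x] e by (auto simp: y_def)

text \<open>With \<open>a\<close> in place of \<open>y e\<close> the terms would cancel by the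
  equation for \<open>k\<close>. After the replacement each remaining term carries the factor y - a
  = e, and its coefficient is bounded because a / y <= 1 and k = O(a^2).\<close>

lemma f_ODE_defect:
  assumes x: "x \<in> {l<..<r}"
  shows "\<bar>2 * a x * f1 e x - V1 x * f e x - (a x - c)\<bar> \<le> 48 * M ^ 11 * e"
proof -
  have x': "x \<in> {l..r}" using x by auto
  note ap = a_pos[OF x] and yp = y_pos[OF x']
  have 1: "2 * a x * k1 x = 2 * (a x)\<^sup>2 * w x - V1 x * k x"
    using ap by (simp add: k1_def field_simps power2_eq_square)
  have 2: "2 * a x * w x = a x - c * (2 * a x * s + 1 - V1 x * f0 x)"
    using ap by (simp add: w_def w0_def H_def field_simps)
  have "2 * a x * f1 e x - V1 x * f e x - (a x - c)
    = (2 * a x * c * s - V1 x * c * f0 x + c - a x)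
      + (2 * a x * k1 x - V1 x * k x) / y e x + 2 * a x * V1 x * k x / (y e x)\<^sup>2"
    by (simp add: f1_def f_def algebra_simps diff_divide_distrib)
  also have "2 * a x * c * s - V1 x * c * f0 x + c - a x = - (2 * a x * w x)"
    unfolding 2 by (simp add: algebra_simps)
  also have "- (2 * a x * w x) + (2 * a x * k1 x - V1 x * k x) / y e x + 2 * a x * V1 x * k x / (y e x)\<^sup>2
    = - (2 * w x * (a x / y e x) * (y e x - a x)) - 2 * V1 x * (k x / (y e x)\<^sup>2) * (y e x - a x)"
    unfolding 1 using yp by (simp add: field_simps power2_eq_square)
  also have "y e x - a x = e" by (simp add: y_def)
  finally have eq: "2 * a x * f1 e x - V1 x * f e x - (a x - c)
    = - (2 * w x * (a x / y e x) * e) - 2 * V1 x * (k x / (y e x)\<^sup>2) * e" .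
  have A: "\<bar>2 * w x * (a x / y e x) * e\<bar> \<le> 2 * (5 * M ^ 6) * 1 * e"
    unfolding abs_mult using w_le[OF x'] a_div_y[OF x'] e M by (intro mult_mono) auto
  have "\<bar>k x / (y e x)\<^sup>2\<bar> \<le> 5 * M ^ 8 * (a x / y e x)\<^sup>2"
    using k_le[OF x'] yp by (simp add: power_divide divide_right_mono)
  also have "\<dots> \<le> 5 * M ^ 8 * 1"
    using power_le_one[OF a_div_y[OF x'], of 2] M by (intro mult_left_mono) auto
  finally have B: "\<bar>2 * V1 x * (k x / (y e x)\<^sup>2) * e\<bar> \<le> 2 * M * (5 * M ^ 8 * 1) * e"
    unfolding abs_mult using V1_le[OF x'] e M by (intro mult_mono) auto
  have "\<bar>- u - u'\<bar> \<le> b + b'" if "\<bar>u\<bar> \<le> b" "\<bar>u'\<bar> \<le> b'" for u u' b b' :: real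
    using that by linarith
  from this[OF A B] have "\<bar>2 * a x * f1 e x - V1 x * f e x - (a x - c)\<bar>
    \<le> 2 * (5 * M ^ 6) * 1 * e + 2 * M * (5 * M ^ 8 * 1) * e"
    unfolding eq .
  moreover have "2 * M * (5 * M ^ 8 * 1) * e = 10 * M ^ 9 * e" by (simp add: eval_nat_numeral)
  moreover have "M ^ 9 * e \<le> M ^ 11 * e" "M ^ 6 * e \<le> M ^ 11 * e" "0 \<le> M ^ 11 * e"
    using e M by (auto intro: mult_right_mono M_mono)
  ultimately show ?thesis by linarith
qed

text \<open>Each power of 1 / y beyond the first is paired with a factor \<open>a\<close> from the
  bounds on \<open>k\<close> and \<open>k1\<close>, and a / y <= 1; the last 1 / y is at most 1 /
  e.\<close>

lemma f2_le:
  assumes x: "x \<in> {l<..<r}"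
  shows "\<bar>f2 e x\<bar> \<le> 48 * M ^ 11 / e"
proof -
  have x': "x \<in> {l..r}" using x by auto
  define z where "z = y e x"
  note ap = a_pos[OF x] and zp = y_pos[OF x', folded z_def] and q = a_div_y[OF x', folded z_def]
  have ez: "1 / z \<le> 1 / e" using e a_nonneg[OF x'] by (simp add: z_def y_def frac_le)
  have M11: "0 \<le> M ^ 11" using M by simp
  have 1: "\<bar>k2 x / z\<bar> \<le> 17 * M ^ 11 * (1 / e)"
  proof -
    have "\<bar>k2 x\<bar> * (1 / z) \<le> 17 * M ^ 11 * (1 / e)"
      by (rule mult_mono) (use k2_le[OF x] ez zp M11 in auto)
    then show ?thesis using zp by simp
  qed
  have 2: "\<bar>2 * k1 x * V1 x / z\<^sup>2\<bar> \<le> 16 * M ^ 11 * (1 / e)"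
  proof -
    have "\<bar>2 * k1 x * V1 x / z\<^sup>2\<bar> = 2 * \<bar>k1 x\<bar> * \<bar>V1 x\<bar> / z\<^sup>2" using zp by (simp add: abs_mult)
    also have "\<dots> \<le> 2 * (8 * M ^ 9 * a x) * M / z\<^sup>2"
      using k1_le[OF x'] V1_le[OF x'] M ap by (intro divide_right_mono mult_mono) auto
    also have "\<dots> = 16 * M ^ 10 * (a x / z) * (1 / z)"
      by (simp add: power2_eq_square eval_nat_numeral)
    also have "\<dots> \<le> 16 * M ^ 11 * 1 * (1 / e)"
      using q ez zp M11 M_mono[of 10 11] M by (intro mult_mono) auto
    finally show ?thesis by simp
  qed
  have 3: "\<bar>k x * V2 x / z\<^sup>2\<bar> \<le> 5 * M ^ 11 * (1 / e)"
  proof -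
    have "\<bar>k x * V2 x / z\<^sup>2\<bar> = \<bar>k x\<bar> * \<bar>V2 x\<bar> / z\<^sup>2" using zp by (simp add: abs_mult)
    also have "\<dots> \<le> 5 * M ^ 8 * (a x)\<^sup>2 * M / z\<^sup>2"
      using k_le[OF x'] V2_le[OF x'] M ap by (intro divide_right_mono mult_mono) auto
    also have "\<dots> = 5 * M ^ 9 * a x * (a x / z) * (1 / z)"
      by (simp add: power2_eq_square eval_nat_numeral)
    also have "\<dots> \<le> 5 * M ^ 9 * M\<^sup>2 * 1 * (1 / e)"
      using q ez zp M a_le[OF x'] ap by (intro mult_mono) auto
    also have "\<dots> = 5 * M ^ 11 * (1 / e)" by (simp add: eval_nat_numeral)
    finally show ?thesis .
  qed
  have 4: "\<bar>2 * k x * (V1 x)\<^sup>2 / z ^ 3\<bar> \<le> 10 * M ^ 11 * (1 / e)"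
  proof -
    have "\<bar>2 * k x * (V1 x)\<^sup>2 / z ^ 3\<bar> = 2 * \<bar>k x\<bar> * \<bar>V1 x\<bar>\<^sup>2 / z ^ 3" using zp by (simp add: abs_mult)
    also have "\<dots> \<le> 2 * (5 * M ^ 8 * (a x)\<^sup>2) * M\<^sup>2 / z ^ 3"
      using k_le[OF x'] power_mono[OF V1_le[OF x'], of 2] M ap zp
      by (intro divide_right_mono mult_mono) auto
    also have "\<dots> = 10 * M ^ 10 * (a x / z)\<^sup>2 * (1 / z)"
      by (simp add: power2_eq_square eval_nat_numeral mult_ac)
    also have "\<dots> \<le> 10 * M ^ 11 * 1 * (1 / e)"
      using power_le_one[OF q, of 2] ez zp M11 M_mono[of 10 11] M by (intro mult_mono) auto
    finally show ?thesis by simp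
  qed
  have "\<bar>f2 e x\<bar> \<le> \<bar>k2 x / z\<bar> + \<bar>2 * k1 x * V1 x / z\<^sup>2\<bar> + \<bar>k x * V2 x / z\<^sup>2\<bar> + \<bar>2 * k x * (V1 x)\<^sup>2 / z ^ 3\<bar>"
    unfolding f2_def z_def by linarith
  \<comment> \<open>48 = 17 + 16 + 5 + 10. The same constant is used for the end values of
    \<open>f1\<close> and for the defect, so that a single \<open>K\<close> serves in
    \<open>well_balance\<close>.\<close>
  also have "\<dots> \<le> 48 * M ^ 11 * (1 / e)" using 1 2 3 4 by linarith
  finally show ?thesis by simp
qed

end

end

section \<open>Identification of \<open>c\<close> with \<open>K_cl\<close>, and the energy bound for
  a single well\<close>

lemma compact_strict_lower_bound:
  fixes g :: "real \<Rightarrow> real"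
  assumes "compact S" "continuous_on S g" "\<And>x. x \<in> S \<Longrightarrow> 0 < g x"
  obtains \<kappa> where "0 < \<kappa>" "\<And>x. x \<in> S \<Longrightarrow> \<kappa> \<le> g x"
proof (cases "S = {}")
  \<comment> \<open>The empty case does occur: the compact set between the well and the region at
    infinity is empty when the latter begins early.\<close>
  case True
  then show ?thesis using that[of 1] by auto
next
  case False
  then obtain z where "z \<in> S" "\<And>x. x \<in> S \<Longrightarrow> g z \<le> g x"
    using continuous_attains_inf[OF assms(1) False assms(2)] by auto
  then show ?thesis using that[of "g z"] assms(3) by auto
qed

text \<open>Bridge between the Lebesgue integrals of \<open>K_cl\<close> and the gauge integrals
  used for \<open>c\<close>; nonnegativity gives absolute integrability even for the unbounded 1 /
  p.\<close>

lemma set_lborel_integral_nonneg: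
  fixes g :: "real \<Rightarrow> real"
  assumes "g \<in> borel_measurable borel" "g integrable_on {l..r}" "\<And>x. x \<in> {l..r} \<Longrightarrow> 0 \<le> g x"
  shows "(LBINT x:{l..r}. g x) = integral {l..r} g"
proof -
  have "g absolutely_integrable_on {l..r}"
    by (rule nonnegative_absolutely_integrable_1) (use assms in auto)
  then have "set_integrable lborel {l..r} g"
    unfolding set_integrable_def
    by (rule integrable_completion[THEN iffD1, rotated]) (use assms(1) in simp)
  then show ?thesis by (rule set_borel_integral_eq_integral)
qed

context potential_well
begin

lemma K_cl_eq:
  assumes "x_minus V lam = l" "x_plus V lam = r"
  shows "K_cl V lam = c"
proof -
  have J: "(LBINT x:{l..r}. (lam - V x) powr (1/2)) = integral {l..r} p"
  proof -
    have "(LBINT x:{l..r}. (lam - V x) powr (1/2)) = (LBINT x:{l..r}. p x)"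
      by (rule set_lebesgue_integral_cong) (use a_nonneg in \<open>auto simp: p_def a_def powr_half_sqrt\<close>)
    also have "\<dots> = integral {l..r} p"
      by (rule set_lborel_integral_nonneg)
        (auto intro: borel_measurable_continuous_onI integrable_continuous_real cont_p p_nonneg)
    finally show ?thesis .
  qed
  have T: "(LBINT x:{l..r}. (lam - V x) powr (-1/2)) = integral {l..r} (\<lambda>x. 1 / p x)"
  proof -
    \<comment> \<open>At the turning points both sides are 0, since \<open>0 powr (-1/2)\<close> and
      \<open>1 / 0\<close> are both 0.\<close>
    have "(lam - V x) powr (-1/2) = 1 / p x" if "x \<in> {l..r}" for x
      using a_nonneg[OF that] powr_minus[of "a x" "1/2"]
      by (simp add: p_def a_def powr_half_sqrt inverse_eq_divide)
    then have "(LBINT x:{l..r}. (lam - V x) powr (-1/2)) = (LBINT x:{l..r}. 1 / p x)"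
      by (intro set_lebesgue_integral_cong) auto
    also have "\<dots> = integral {l..r} (\<lambda>x. 1 / p x)"
    proof (rule set_lborel_integral_nonneg[OF _ inverse_p_integrable])
      have "p \<in> borel_measurable borel" by (intro borel_measurable_continuous_onI cont_p)
      then show "(\<lambda>x. 1 / p x) \<in> borel_measurable borel" by simp
    qed (simp add: p_nonneg)
    finally show ?thesis .
  qed
  show ?thesis unfolding K_cl_def assms J T c_def by (simp add: divide_inverse)
qed

lemma kinetic_energy_bound:
  assumes h: "0 < h" "h \<le> 1"
    and right: "\<And>x. x \<in> {r..B + 1/M} \<Longrightarrow> \<bar>V1 x - V1 r\<bar> \<le> M * (x - r)"
      "\<And>x. x \<in> {r..B + 1/M} \<Longrightarrow> x - r \<le> M * (V x - lam)"
      "\<And>x. B \<le> x \<Longrightarrow> 1 \<le> M * (V x - lam)"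
    and left: "\<And>x. x \<in> {A - 1/M..l} \<Longrightarrow> \<bar>V1 x - V1 l\<bar> \<le> M * (l - x)"
      "\<And>x. x \<in> {A - 1/M..l} \<Longrightarrow> l - x \<le> M * (V x - lam)"
      "\<And>x. x \<le> A \<Longrightarrow> 1 \<le> M * (V x - lam)"
    and AB: "A \<le> l" "r \<le> B"
    and ef: "eigenfunction V h lam \<psi>" and norm: "(LBINT x. (\<psi> x)\<^sup>2) = 1"
  defines "K \<equiv> 48 * M ^ 11"
  shows "integrable lborel (\<lambda>x. (deriv \<psi> x)\<^sup>2)"
    and "\<bar>kinetic_energy h \<psi> - c\<bar>
      \<le> (K * (1 + M\<^sup>2) + (K + 3 * K * M ^ 3 + 1) * (6 * M ^ 4)) * sqrt h"
proof -
  have d: "(\<psi> has_real_derivative deriv \<psi> x) (at x)" for x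
    using ef by (simp add: eigenfunction_def DERIV_deriv_iff_real_differentiable)
  have d1: "(deriv \<psi> has_real_derivative (V x - lam) / h\<^sup>2 * \<psi> x) (at x)" for x
  proof -
    have "(deriv \<psi> has_real_derivative deriv (deriv \<psi>) x) (at x)"
      using ef by (simp add: eigenfunction_def DERIV_deriv_iff_real_differentiable)
    moreover have "- h\<^sup>2 * deriv (deriv \<psi>) x + V x * \<psi> x = lam * \<psi> x"
      using ef by (simp add: eigenfunction_def numeral_2_eq_2)
    then have "deriv (deriv \<psi>) x = (V x - lam) / h\<^sup>2 * \<psi> x"
      using h by (simp add: field_simps)
    ultimately show ?thesis by simp
  qed
  have int: "integrable lborel (\<lambda>x. (\<psi> x)\<^sup>2)" using ef by (simp add: eigenfunction_def)
  \<comment> \<open>From here on \<open>sqrt h\<close> is the regularisation parameter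
    \<open>e\<close>.\<close>
  have sh: "0 < sqrt h" using h by simp
  have cK: "c \<le> K"
  proof -
    have "M\<^sup>2 \<le> M ^ 11" "0 \<le> M ^ 11" using M by (auto intro: M_mono)
    then show ?thesis using c_le unfolding K_def by linarith
  qed
  note wb = well_balance[OF M h dV cont_V1 width V1_le _ _ ends right left AB d d1 int norm c_nonneg cK
      cont_f[OF sh] cont_f1[OF sh] df[OF sh] df1[OF sh] f_ends[OF sh]
      f1_ends[OF sh, folded K_def] f_ODE_defect[OF sh, folded K_def, unfolded a_def] f2_le[OF sh, folded K_def]]
  show "integrable lborel (\<lambda>x. (deriv \<psi> x)\<^sup>2)"
    by (rule wb(1)) (use a_nonneg a_le in \<open>simp_all add: a_def\<close>)
  show "\<bar>kinetic_energy h \<psi> - c\<bar>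
      \<le> (K * (1 + M\<^sup>2) + (K + 3 * K * M ^ 3 + 1) * (6 * M ^ 4)) * sqrt h"
    unfolding kinetic_energy_def
    by (rule wb(2)) (use a_nonneg a_le in \<open>simp_all add: a_def\<close>)
qed

end

section \<open>Uniformity in the spectral parameter\<close>

text \<open>\<open>M\<close>, \<open>A\<close> and \<open>B\<close> are chosen before
  \<open>lam\<close>. Near the old turning points v is strictly monotone with slope at least m, and
  elsewhere it stays at least \<kappa> away from lam0; a shift of the level by less than \<kappa> /
  2 therefore moves each turning point within its monotone zone and creates no new one.\<close>

lemma turning_points_perturbation:
  fixes v :: "real \<Rightarrow> real" and lam0 :: real
  assumes C2: "Ck_on 2 v UNIV" and B: "assumption_B v lam0"
  obtains \<eta> M A B where "0 < \<eta>"
    "\<And>lam. \<bar>lam - lam0\<bar> < \<eta> \<Longrightarrow> \<exists>l r. assumption_B v lam \<and> x_minus v lam = l \<and> x_plus v lam = r \<and>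
      potential_well v (deriv v) (deriv (deriv v)) lam l r M \<and> A \<le> l \<and> r \<le> B \<and>
      (\<forall>x\<in>{r..B + 1/M}. \<bar>deriv v x - deriv v r\<bar> \<le> M * (x - r) \<and> x - r \<le> M * (v x - lam)) \<and>
      (\<forall>x\<ge>B. 1 \<le> M * (v x - lam)) \<and>
      (\<forall>x\<in>{A - 1/M..l}. \<bar>deriv v x - deriv v l\<bar> \<le> M * (l - x) \<and> l - x \<le> M * (v x - lam)) \<and>
      (\<forall>x\<le>A. 1 \<le> M * (v x - lam))"
proof -
  define v1 where "v1 = deriv v"
  define v2 where "v2 = deriv v1"
  have dv: "(v has_real_derivative v1 x) (at x)" and dv1: "(v1 has_real_derivative v2 x) (at x)" for x
    using C2 by (auto simp: Ck_on_def v1_def v2_def DERIV_deriv_iff_real_differentiable numeral_2_eq_2 less_Suc_eq)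
  have cv2: "continuous_on S v2" for S
    using C2 by (auto simp: Ck_on_def v1_def v2_def numeral_2_eq_2 intro: continuous_on_subset)
  have cv: "continuous_on S v" and cv1: "continuous_on S v1" for S
    by (auto intro!: continuous_at_imp_continuous_on DERIV_isCont dv dv1)
  define l0 where "l0 = x_minus v lam0"
  define r0 where "r0 = x_plus v lam0"
  have card: "card {x. v x = lam0} = 2"
    and inside: "\<And>x. x \<in> {l0<..<r0} \<Longrightarrow> v x < lam0"
    and outside: "\<And>x. x \<notin> {l0..r0} \<Longrightarrow> lam0 < v x"
    and lim: "ereal lam0 < Liminf at_infinity (\<lambda>x. ereal (v x))"
    and slopes: "0 < v1 r0" "v1 l0 < 0"
    using B unfolding assumption_B_def l0_def r0_def v1_def by auto
  obtain Nl Nr where N: "open Nl" "l0 \<in> Nl" "Ck_on 3 v Nl" "open Nr" "r0 \<in> Nr" "Ck_on 3 v Nr"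
    using B unfolding assumption_B_def l0_def r0_def by blast
  have lr0: "l0 < r0" and v0: "v l0 = lam0" "v r0 = lam0"
  proof -
    obtain x y where xy: "{x. v x = lam0} = {x, y}" "x \<noteq> y" using card by (meson card_2_iff)
    have "l0 = min x y" "r0 = max x y" unfolding l0_def r0_def x_minus_def x_plus_def xy by auto
    moreover have "v x = lam0" "v y = lam0" using xy(1) by auto
    ultimately show "l0 < r0" "v l0 = lam0" "v r0 = lam0" using xy(2) by (auto simp: min_def max_def)
  qed
  \<comment> \<open>Half of the smaller slope, so that the strict inequalities persist on
    neighbourhoods.\<close>
  define m where "m = min (- v1 l0) (v1 r0) / 2"
  have m: "0 < m" "v1 l0 < - m" "m < v1 r0" using slopes by (auto simp: m_def min_def)
  have open1: "open {x. v1 x < - m}" "open {x. m < v1 x}"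
    by (intro open_Collect_less cv1 continuous_intros)+
  obtain d1 where d1: "0 < d1" "ball l0 d1 \<subseteq> Nl \<inter> {x. v1 x < - m}"
    by (rule openE[OF open_Int[OF N(1) open1(1)], of l0]) (use N m in auto)
  obtain d2 where d2: "0 < d2" "ball r0 d2 \<subseteq> Nr \<inter> {x. m < v1 x}"
    by (rule openE[OF open_Int[OF N(4) open1(2)], of r0]) (use N m in auto)
  \<comment> \<open>The turning points will move by at most d, \<open>A\<close> and \<open>B\<close>
    lie at distance 2 d, and the margin 1/M <= d stays within the radius 3 d of slope control. The
    divisor 8 also keeps the two zones apart.\<close>
  define d where "d = min (min d1 d2) (r0 - l0) / 8"
  have d: "0 < d" "3 * d < d1" "3 * d < d2" "8 * d \<le> r0 - l0"
    using d1(1) d2(1) lr0 by (auto simp: d_def min_def)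
  have near_l: "x \<in> Nl" "v1 x < - m" if "\<bar>x - l0\<bar> \<le> 3 * d" for x
    using d1(2) d that by (auto simp: ball_def dist_real_def subset_iff abs_minus_commute)
  have near_r: "x \<in> Nr" "m < v1 x" if "\<bar>x - r0\<bar> \<le> 3 * d" for x
    using d2(2) d that by (auto simp: ball_def dist_real_def subset_iff abs_minus_commute)
  obtain y R where y: "lam0 < y" "\<And>x. R \<le> \<bar>x\<bar> \<Longrightarrow> y < v x"
  proof -
    obtain y where y: "ereal lam0 < ereal y" "ereal y < Liminf at_infinity (\<lambda>x. ereal (v x))"
      using ereal_dense2[OF lim] by blast
    have "\<forall>\<^sub>F x in at_infinity. ereal y < ereal (v x)"
      using iffD1[OF le_Liminf_iff order_refl] y(2) by blast
    then have "\<forall>\<^sub>F x in at_infinity. y < v x" by simp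
    then show ?thesis using that y(1) unfolding eventually_at_infinity by (auto simp: real_norm_def)
  qed
  obtain \<kappa>1 where k1: "0 < \<kappa>1" "\<And>x. x \<in> {- \<bar>R\<bar>..l0 - d} \<union> {r0 + d..\<bar>R\<bar>} \<Longrightarrow> \<kappa>1 \<le> v x - lam0"
  proof (rule compact_strict_lower_bound[of "{- \<bar>R\<bar>..l0 - d} \<union> {r0 + d..\<bar>R\<bar>}" "\<lambda>x. v x - lam0"])
    show "compact ({- \<bar>R\<bar>..l0 - d} \<union> {r0 + d..\<bar>R\<bar>})" by (intro compact_Un) auto
  qed (use outside d in \<open>auto intro!: continuous_intros cv\<close>)
  obtain \<kappa>2 where k2: "0 < \<kappa>2" "\<And>x. x \<in> {l0 + d..r0 - d} \<Longrightarrow> \<kappa>2 \<le> lam0 - v x"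
    by (rule compact_strict_lower_bound[of "{l0 + d..r0 - d}" "\<lambda>x. lam0 - v x"])
      (use inside d in \<open>auto intro!: continuous_intros cv\<close>)
  \<comment> \<open>The gap to the level lam0: \<open>\<kappa>1\<close> serves the bounded outer
    part, \<open>\<kappa>2\<close> the middle of the well, and y - lam0 the region at
    infinity.\<close>
  define \<kappa> where "\<kappa> = min (min \<kappa>1 \<kappa>2) (y - lam0)"
  have kap: "0 < \<kappa>" "\<kappa> \<le> \<kappa>1" "\<kappa> \<le> \<kappa>2" "\<kappa> \<le> y - lam0" using k1 k2 y by (auto simp: \<kappa>_def)
  have far: "lam0 + \<kappa> \<le> v x" if "x \<le> l0 - d \<or> r0 + d \<le> x" for x
  proof (cases "R \<le> \<bar>x\<bar>")
    case True
    then show ?thesis using y(2)[of x] kap by simp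
  next
    case False
    then have "x \<in> {- \<bar>R\<bar>..l0 - d} \<union> {r0 + d..\<bar>R\<bar>}" using that by auto
    then show ?thesis using k1(2)[of x] kap by simp
  qed
  have mid: "v x \<le> lam0 - \<kappa>" if "x \<in> {l0 + d..r0 - d}" for x
    using k2(2)[OF that] kap by simp
  define I where "I = {l0 - 3 * d..r0 + 3 * d}"
  have "compact I" by (simp add: I_def)
  obtain b1 where b1: "\<And>x. x \<in> I \<Longrightarrow> \<bar>v1 x\<bar> \<le> b1"
    using compact_imp_bounded[OF compact_continuous_image[OF cv1 \<open>compact I\<close>]] by (auto simp: bounded_iff)
  obtain b2 where b2: "\<And>x. x \<in> I \<Longrightarrow> \<bar>v2 x\<bar> \<le> b2"
    using compact_imp_bounded[OF compact_continuous_image[OF cv2 \<open>compact I\<close>]] by (auto simp: bounded_iff)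
  define w where "w = r0 - l0 + 2 * d"
  have w: "0 < w" using lr0 d by (simp add: w_def)
  \<comment> \<open>1/d bounds the width from below and ensures 1/M <= d; w bounds it from above;
    1/m serves the slopes and the zones near the ends; 2/\<kappa> the far region and 2 w/\<kappa>
    the middle of the well, where half of the gap remains.\<close>
  define M where "M = Max {1, b1, b2, 1 / d, w, 1 / m, 2 / \<kappa>, 2 * w / \<kappa>}"
  have M: "1 \<le> M" "b1 \<le> M" "b2 \<le> M" "1 / d \<le> M" "w \<le> M" "1 / m \<le> M" "2 / \<kappa> \<le> M" "2 * w / \<kappa> \<le> M"
    unfolding M_def by (rule Max_ge; simp)+
  have Md: "1 \<le> M * d" and Mm: "1 \<le> M * m" and Mk: "2 \<le> M * \<kappa>" and Mw: "2 * w \<le> M * \<kappa>"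
    using M d m kap by (auto simp: field_simps)
  have M0: "0 < M" using M by simp
  have Minv: "1 / M \<le> d" using Md M0 by (simp add: field_simps mult.commute)
  show ?thesis
  proof (rule that[of "\<kappa> / 2" M "l0 - 2 * d" "r0 + 2 * d"])
    show "0 < \<kappa> / 2" using kap by simp
    fix lam assume lam: "\<bar>lam - lam0\<bar> < \<kappa> / 2"
    have lam': "lam < lam0 + \<kappa>" "lam0 - \<kappa> < lam" using lam kap by linarith+
    obtain l where l: "l0 - d \<le> l" "l \<le> l0 + d" "v l = lam"
      using IVT2'[of v "l0 + d" lam "l0 - d"] far[of "l0 - d"] mid[of "l0 + d"] lam' d cv by auto
    obtain r where r: "r0 - d \<le> r" "r \<le> r0 + d" "v r = lam"
      using IVT'[of v "r0 - d" lam "r0 + d"] far[of "r0 + d"] mid[of "r0 - d"] lam' d cv by auto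
    have lr: "l < r" using l r d by linarith
    have decr: "m * (x' - x) \<le> v x - v x'" if "l0 - 3 * d \<le> x" "x \<le> x'" "x' \<le> l0 + 3 * d" for x x'
    proof -
      have "v x' + m * x' \<le> v x + m * x"
      proof (rule DERIV_nonpos_imp_nonincreasing[OF that(2)])
        fix z assume "x \<le> z" "z \<le> x'"
        then have "\<bar>z - l0\<bar> \<le> 3 * d" using that by auto
        then show "\<exists>D. ((\<lambda>z. v z + m * z) has_real_derivative D) (at z) \<and> D \<le> 0"
          using near_l(2)[of z] by (intro exI[of _ "v1 z + m"]) (auto intro!: derivative_eq_intros dv)
      qed
      then show ?thesis by (simp add: algebra_simps)
    qed
    have incr: "m * (x' - x) \<le> v x' - v x" if "r0 - 3 * d \<le> x" "x \<le> x'" "x' \<le> r0 + 3 * d" for x x'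
    proof -
      have "v x - m * x \<le> v x' - m * x'"
      proof (rule DERIV_nonneg_imp_nondecreasing[OF that(2)])
        fix z assume "x \<le> z" "z \<le> x'"
        then have "\<bar>z - r0\<bar> \<le> 3 * d" using that by auto
        then show "\<exists>D. ((\<lambda>z. v z - m * z) has_real_derivative D) (at z) \<and> 0 \<le> D"
          using near_r(2)[of z] by (intro exI[of _ "v1 z - m"]) (auto intro!: derivative_eq_intros dv)
      qed
      then show ?thesis by (simp add: algebra_simps)
    qed
    have scale: "t \<le> M * u" if "m * t \<le> u" "0 \<le> t" for t u
    proof -
      have "t * 1 \<le> t * (M * m)" by (rule mult_left_mono[OF Mm that(2)])
      also have "\<dots> = M * (m * t)" by simp
      also have "\<dots> \<le> M * u" by (rule mult_left_mono) (use that M0 in auto)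
      finally show ?thesis by simp
    qed
    have kscale: "M * (\<kappa> / 2) \<le> M * u" if "\<kappa> / 2 \<le> u" for u
      by (rule mult_left_mono) (use that M0 in auto)
    have farM: "1 \<le> M * (v x - lam)" if "x \<le> l0 - d \<or> r0 + d \<le> x" for x
    proof -
      have "\<kappa> / 2 \<le> v x - lam" using far[OF that] lam by linarith
      from kscale[OF this] Mk show ?thesis by linarith
    qed
    have left: "l - x \<le> M * (v x - lam)" if "l0 - 3 * d \<le> x" "x \<le> l" for x
      by (rule scale) (use decr[of x l] that l d in auto)
    have right: "x - r \<le> M * (v x - lam)" if "r \<le> x" "x \<le> r0 + 3 * d" for x
      by (rule scale) (use incr[of r x] that r d in auto)
    have well: "min (x - l) (r - x) \<le> M * (lam - v x)" if x: "x \<in> {l..r}" for x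
    proof -
      \<comment> \<open>Near an end the slope bound compares lam - v with the distance to it; in the
        middle the remaining gap \<kappa> / 2, scaled by \<open>M\<close>, exceeds the whole
        width.\<close>
      consider "x \<le> l0 + 3 * d" | "r0 - 3 * d \<le> x" | "l0 + d \<le> x" "x \<le> r0 - d"
        using d by linarith
      then show ?thesis
      proof cases
        case 1
        have "x - l \<le> M * (lam - v x)"
          by (rule scale) (use decr[of l x] 1 x l d in auto)
        then show ?thesis by simp
      next
        case 2
        have "r - x \<le> M * (lam - v x)"
          by (rule scale) (use incr[of x r] 2 x r d in auto)
        then show ?thesis by simp
      next
        case 3
        have "v x \<le> lam0 - \<kappa>" using mid[of x] 3 by auto
        then have "\<kappa> / 2 \<le> lam - v x" using lam by linarith
        from kscale[OF this] have "w \<le> M * (lam - v x)" using Mw by linarith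
        moreover have "x - l \<le> w" using x l r by (simp add: w_def)
        ultimately show ?thesis by linarith
      qed
    qed
    have neg: "v x < lam" if "x \<in> {l<..<r}" for x
    proof -
      have "0 < M * (lam - v x)" using well[of x] that by auto
      then show ?thesis using M0 by (simp add: zero_less_mult_iff)
    qed
    have pos: "lam < v x" if "x \<notin> {l..r}" for x
    proof -
      have "0 < M * (v x - lam)"
      proof (cases "x \<le> l0 - d \<or> r0 + d \<le> x")
        case True
        then show ?thesis using farM[of x] by linarith
      next
        case False
        then show ?thesis using left[of x] right[of x] that d by fastforce
      qed
      then show ?thesis using M0 by (simp add: zero_less_mult_iff)
    qed
    have level: "{x. v x = lam} = {l, r}"
    proof -
      have "x = l \<or> x = r" if "v x = lam" for x
        using neg[of x] pos[of x] that by fastforce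
      then show ?thesis using l r by auto
    qed
    have xm: "x_minus v lam = l" and xp: "x_plus v lam = r"
      using lr by (auto simp: x_minus_def x_plus_def level)
    have ld: "\<bar>l - l0\<bar> \<le> 3 * d" and rd: "\<bar>r - r0\<bar> \<le> 3 * d" using l r d by auto
    have "assumption_B v lam"
      unfolding assumption_B_def xm xp
    proof (intro conjI)
      show "card {x. v x = lam} = 2" using lr by (simp add: level)
      show "\<forall>x\<in>{l<..<r}. v x < lam" using neg by blast
      show "\<forall>x. x \<notin> {l..r} \<longrightarrow> lam < v x" using pos by blast
      have "ereal (lam0 + \<kappa>) \<le> Liminf at_infinity (\<lambda>x. ereal (v x))"
      proof (rule Liminf_bounded)
        have "\<forall>x. max \<bar>l0 - d\<bar> \<bar>r0 + d\<bar> \<le> norm x \<longrightarrow> ereal (lam0 + \<kappa>) \<le> ereal (v x)"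
          using far by (auto simp: abs_if split: if_splits)
        then show "\<forall>\<^sub>F x in at_infinity. ereal (lam0 + \<kappa>) \<le> ereal (v x)"
          unfolding eventually_at_infinity by blast
      qed
      then show "ereal lam < Liminf at_infinity (\<lambda>x. ereal (v x))"
        using lam'(1) by (meson less_ereal.simps(1) less_le_trans)
      show "\<exists>N. open N \<and> l \<in> N \<and> Ck_on 3 v N" using N near_l(1)[OF ld] by blast
      show "\<exists>N. open N \<and> r \<in> N \<and> Ck_on 3 v N" using N near_r(1)[OF rd] by blast
      show "0 < deriv v r" "0 < - deriv v l"
        using near_l(2)[OF ld] near_r(2)[OF rd] m by (auto simp: v1_def)
    qed
    moreover have "potential_well v v1 v2 lam l r M"
    proof
      have "M * d \<le> M * (r - l)" by (rule mult_left_mono) (use l r d M0 in auto)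
      then show "1 \<le> M * (r - l)" using Md by linarith
      show "r - l \<le> M" using l r M by (simp add: w_def)
      have "M * m \<le> M * v1 r" "M * m \<le> M * (- v1 l)"
        by (rule mult_left_mono; use near_l(2)[OF ld] near_r(2)[OF rd] M0 in linarith)+
      then show "1 \<le> M * v1 r" "1 \<le> M * (- v1 l)" using Mm by linarith+
      fix x assume x: "x \<in> {l..r}"
      then have "x \<in> I" using l r d by (auto simp: I_def)
      then show "\<bar>v1 x\<bar> \<le> M" "\<bar>v2 x\<bar> \<le> M" using b1[of x] b2[of x] M by auto
      show "min (x - l) (r - x) \<le> M * (lam - v x)" by (rule well[OF x])
    qed (use M dv dv1 l r in auto)
    moreover have lip: "\<bar>v1 x - v1 y\<bar> \<le> M * \<bar>x - y\<bar>" if "x \<in> I" "y \<in> I" for x y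
      by (rule abs_diff_le_real_derivative[OF dv1, where S=I])
        (use that b2 M in \<open>auto simp: I_def intro: order.trans\<close>)
    have "\<bar>v1 x - v1 r\<bar> \<le> M * (x - r) \<and> x - r \<le> M * (v x - lam)"
      if "x \<in> {r..r0 + 2 * d + 1/M}" for x
      using lip[of x r] right[of x] that Minv l r d by (auto simp: I_def)
    moreover have "\<bar>v1 x - v1 l\<bar> \<le> M * (l - x) \<and> l - x \<le> M * (v x - lam)"
      if "x \<in> {l0 - 2 * d - 1/M..l}" for x
      using lip[of x l] left[of x] that Minv l r d by (auto simp: I_def)
    moreover have "1 \<le> M * (v x - lam)" if "r0 + 2 * d \<le> x \<or> x \<le> l0 - 2 * d" for x
      by (rule farM) (use that d in auto)
    moreover have "l0 - 2 * d \<le> l" "r \<le> r0 + 2 * d" using l r d by auto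
    ultimately show "\<exists>l r. assumption_B v lam \<and> x_minus v lam = l \<and> x_plus v lam = r \<and>
      potential_well v (deriv v) (deriv (deriv v)) lam l r M \<and> l0 - 2 * d \<le> l \<and> r \<le> r0 + 2 * d \<and>
      (\<forall>x\<in>{r..r0 + 2 * d + 1/M}. \<bar>deriv v x - deriv v r\<bar> \<le> M * (x - r) \<and> x - r \<le> M * (v x - lam)) \<and>
      (\<forall>x\<ge>r0 + 2 * d. 1 \<le> M * (v x - lam)) \<and>
      (\<forall>x\<in>{l0 - 2 * d - 1/M..l}. \<bar>deriv v x - deriv v l\<bar> \<le> M * (l - x) \<and> l - x \<le> M * (v x - lam)) \<and>
      (\<forall>x\<le>l0 - 2 * d. 1 \<le> M * (v x - lam))"
      using xm xp unfolding v2_def v1_def by (intro exI[of _ l] exI[of _ r]) blast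
  qed
qed

text \<open>Integrability of the squared derivative accompanies the bound because the integral in
  \<open>kinetic_energy\<close> would otherwise be 0 by convention; \<open>assumption_B\<close>
  throughout U makes the turning points in \<open>K_cl\<close> meaningful.\<close>

theorem corollary4p6:
  fixes v :: "real \<Rightarrow> real" and lam0 :: real
  assumes "assumption_A v lam0" and "assumption_B v lam0"
  shows "\<exists>U h0 C. open U \<and> lam0 \<in> U \<and> h0 > 0 \<and> C > 0 \<and>
           (\<forall>lam\<in>U. assumption_B v lam) \<and>
           (\<forall>h\<in>{0<..h0}. \<forall>lam\<in>U. eigenvalue v h lam \<longrightarrow>
              (\<forall>\<psi>. eigenfunction v h lam \<psi> \<and> (LBINT x. (\<psi> x)\<^sup>2) = 1 \<longrightarrow>
                 integrable lborel (\<lambda>x. (deriv \<psi> x)\<^sup>2) \<and>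
                 \<bar>kinetic_energy h \<psi> - K_cl v lam\<bar> \<le> C * h powr (1/3)))"
proof -
  have "Ck_on 2 v UNIV" using assms(1) by (simp add: assumption_A_def)
  from turning_points_perturbation[OF this assms(2)] obtain \<eta> M A B where \<eta>: "0 < \<eta>"
    and wells: "\<And>lam. \<bar>lam - lam0\<bar> < \<eta> \<Longrightarrow> \<exists>l r. assumption_B v lam \<and> x_minus v lam = l \<and> x_plus v lam = r \<and>
      potential_well v (deriv v) (deriv (deriv v)) lam l r M \<and> A \<le> l \<and> r \<le> B \<and>
      (\<forall>x\<in>{r..B + 1/M}. \<bar>deriv v x - deriv v r\<bar> \<le> M * (x - r) \<and> x - r \<le> M * (v x - lam)) \<and>
      (\<forall>x\<ge>B. 1 \<le> M * (v x - lam)) \<and>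
      (\<forall>x\<in>{A - 1/M..l}. \<bar>deriv v x - deriv v l\<bar> \<le> M * (l - x) \<and> l - x \<le> M * (v x - lam)) \<and>
      (\<forall>x\<le>A. 1 \<le> M * (v x - lam))"
    by blast
  define K where "K = 48 * M ^ 11"
  define C where "C = K * (1 + M\<^sup>2) + (K + 3 * K * M ^ 3 + 1) * (6 * M ^ 4)"
  have "1 \<le> M" using wells[of lam0] \<eta> by (auto dest: potential_well.M)
  then have C: "0 < C" by (simp add: C_def K_def add_nonneg_pos)
  have bound: "integrable lborel (\<lambda>x. (deriv \<psi> x)\<^sup>2) \<and> \<bar>kinetic_energy h \<psi> - K_cl v lam\<bar> \<le> C * h powr (1/3)"
    if lam: "\<bar>lam - lam0\<bar> < \<eta>" and h: "0 < h" "h \<le> 1"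
      and \<psi>: "eigenfunction v h lam \<psi>" "(LBINT x. (\<psi> x)\<^sup>2) = 1" for lam h \<psi>
  proof -
    obtain l r where x: "x_minus v lam = l" "x_plus v lam = r"
      and "potential_well v (deriv v) (deriv (deriv v)) lam l r M" and AB: "A \<le> l" "r \<le> B"
      and right: "\<And>x. x \<in> {r..B + 1/M} \<Longrightarrow> \<bar>deriv v x - deriv v r\<bar> \<le> M * (x - r)"
        "\<And>x. x \<in> {r..B + 1/M} \<Longrightarrow> x - r \<le> M * (v x - lam)" "\<And>x. B \<le> x \<Longrightarrow> 1 \<le> M * (v x - lam)"
      and left: "\<And>x. x \<in> {A - 1/M..l} \<Longrightarrow> \<bar>deriv v x - deriv v l\<bar> \<le> M * (l - x)"
        "\<And>x. x \<in> {A - 1/M..l} \<Longrightarrow> l - x \<le> M * (v x - lam)" "\<And>x. x \<le> A \<Longrightarrow> 1 \<le> M * (v x - lam)"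
      using wells[OF lam] by blast
    interpret potential_well v "deriv v" "deriv (deriv v)" lam l r M by fact
    note bounds = kinetic_energy_bound[OF h right left AB \<psi>, folded K_def, folded C_def]
    \<comment> \<open>The rate obtained is h^(1/2), which for h <= 1 is stronger than the required
      h^(1/3).\<close>
    have "sqrt h \<le> h powr (1/3)"
      using powr_mono'[of "1/3" "1/2" h] h by (simp add: powr_half_sqrt)
    then have "C * sqrt h \<le> C * h powr (1/3)" using C by (simp add: mult_left_mono)
    then show ?thesis using bounds K_cl_eq[OF x] by auto
  qed
  have ball: "\<bar>lam - lam0\<bar> < \<eta>" if "lam \<in> ball lam0 \<eta>" for lam
    using that by (simp add: dist_real_def abs_minus_commute)
  show ?thesis
  proof (rule exI[of _ "ball lam0 \<eta>"], rule exI[of _ 1], rule exI[of _ C], intro conjI ballI allI impI)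
    show "assumption_B v lam" if "lam \<in> ball lam0 \<eta>" for lam
      using wells[OF ball[OF that]] by blast
  qed (use \<eta> C bound ball in auto)
qed

end
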